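(* Let $(N,m,a)\in\mathbb T\times\mathbb N\times\mathbb Z$ be such that $N$ has property $(\natural_{m;a})$. Then we can find a proper divisor of $N$ at the cost of $$O\bigl(\phi(m)\,[m^3+m^2(\log N)^2]\,M(\lfloor\log_2 N\rfloor+1)\bigr).$$
   Context: $\mathbb N$ is the set of positive integers; $\mathbb T$ is the set of natural numbers that have at least two distinct prime divisors; $\phi$ is Euler's totient function. A proper divisor of $N$ is a divisor different from $1$ and $N$. $M:\mathbb N\to(0,\infty)$ is a multiplication time function for $\mathbb Z$: for $n\in\mathbb N$, two integers of bit length at most $n$ can be multiplied using at most $M(n)$ word operations (one has $M(n)=O(n\log n)$). Cost means number of word operations. Property $(\natural_{m;a})$: let $m\in\mathbb N\setminus\{1,2\}$, $a\in\mathbb Z$ and $N\in\mathbb T$. For distinct prime divisors $p,q$ of $N$, $N$ has property $(\natural)$ with respect to $(p,q,m;a)$ if $p\nmid m$ and the equation $X^p+Y^p=a$ has a solution $(X_1,Y_1)$ formed by $m$-th roots of unity in an algebraic closure $\overline{\mathbb F_q}$ of $\mathbb F_q$ with $X_1+Y_1\neq a$. $N$ has property $(\natural_{m;a})$ if it has property $(\natural)$ with respect to $(p,q,m;a)$ for some pair $(p,q)$ of distinct prime divisors of $N$. *)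

theory Defs
  imports
    Complex_Main
    "HOL-Library.Log_Nat"
    "HOL-Number_Theory.Number_Theory"
    "HOL-Algebra.Algebraic_Closure"
begin

section \<open>Counting word operations\<close>

text \<open>
  Bounds on the number of word operations refer to a machine with words of some fixed length
  \<open>w > 0\<close>, on which integers of unbounded size are sequences of words. The machine below is the
  usual random access machine with logarithmic cost: a memory cell holds an integer, and every
  elementary operation costs as many word operations as there are words in the integers it
  touches, memory addresses included. The elementary operations are exactly those that take linear
  time on multi-word integers (copying, addition, subtraction, shifts, sign test); in particular
  multiplication and division are not among them.
\<close>

definition bit_length :: "int \<Rightarrow> nat"
  where "bit_length x = floorlog 2 (nat \<bar>x\<bar>)"

text \<open>For \<open>w = 0\<close> this would be the constant 1, i.e. the unit cost measure; \<open>w > 0\<close> is required below.\<close>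

definition num_words :: "nat \<Rightarrow> int \<Rightarrow> nat"
  where "num_words w x = bit_length x div w + 1"

text \<open>
  The memory is divided into arrays with names in \<^typ>\<open>nat\<close>. A program mentions only finitely many
  names, all of them literally, so a name costs nothing; an index is computed at run time and is
  paid for.
\<close>

type_synonym store = "nat \<Rightarrow> int \<Rightarrow> int"

datatype expr =
    Lit int
  | Get nat expr
  | Add expr expr
  | Sub expr expr
  | Shl expr expr
  | Shr expr expr

fun val :: "expr \<Rightarrow> store \<Rightarrow> int" where
  "val (Lit c) s = c"
| "val (Get a i) s = s a (val i s)"
| "val (Add e f) s = val e s + val f s"
| "val (Sub e f) s = val e s - val f s"
| "val (Shl e f) s = val e s * 2 ^ nat (val f s)"
| "val (Shr e f) s = val e s div 2 ^ nat (val f s)"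

text \<open>Each node pays for its value, so an operation pays for its operands and its result.\<close>

fun expr_cost :: "nat \<Rightarrow> expr \<Rightarrow> store \<Rightarrow> nat" where
  "expr_cost w (Lit c) s = num_words w c"
| "expr_cost w (Get a i) s = expr_cost w i s + num_words w (val (Get a i) s)"
| "expr_cost w (Add e f) s = expr_cost w e s + expr_cost w f s + num_words w (val (Add e f) s)"
| "expr_cost w (Sub e f) s = expr_cost w e s + expr_cost w f s + num_words w (val (Sub e f) s)"
| "expr_cost w (Shl e f) s = expr_cost w e s + expr_cost w f s + num_words w (val (Shl e f) s)"
| "expr_cost w (Shr e f) s = expr_cost w e s + expr_cost w f s + num_words w (val (Shr e f) s)"

text \<open>
  \<open>Put a i e\<close> stores \<open>e\<close> in cell \<open>i\<close> of array \<open>a\<close>. The tests of \<open>Cond\<close> and \<open>Loop\<close> ask whether the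
  expression is positive. \<open>Call a i c es\<close> runs \<open>c\<close> as a subroutine on the arguments \<open>es\<close>, with a
  memory of its own, and stores its result in cell \<open>i\<close> of array \<open>a\<close>. That the memory of a subroutine
  is initially zero at no charge is the standard assumption that fresh memory can be initialized
  lazily.
\<close>

datatype program =
    Skip
  | Put nat expr expr
  | Seq program program
  | Cond expr program program
  | Loop expr program
  | Call nat expr program "expr list"

text \<open>The inputs are the first entries of array 0; all other cells are zero.\<close>

definition init_store :: "int list \<Rightarrow> store"
  where "init_store xs = (\<lambda>a i. if a = 0 \<and> 0 \<le> i \<and> i < int (length xs) then xs ! nat i else 0)"

text \<open>The output is cell 0 of array 0.\<close>

definition result :: "store \<Rightarrow> int"
  where "result s = s 0 0"

definition store_update :: "store \<Rightarrow> nat \<Rightarrow> int \<Rightarrow> int \<Rightarrow> store"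
  where "store_update s a i x = s(a := (s a)(i := x))"

text \<open>\<open>exec w c s k t\<close>: started in \<open>s\<close>, \<open>c\<close> terminates in \<open>t\<close> after \<open>k\<close> word operations.\<close>

inductive exec :: "nat \<Rightarrow> program \<Rightarrow> store \<Rightarrow> nat \<Rightarrow> store \<Rightarrow> bool"
  for w :: nat
where
  Skip: "exec w Skip s 1 s"
| Put: "exec w (Put a i e) s (expr_cost w i s + expr_cost w e s)
          (store_update s a (val i s) (val e s))"
| Seq: "exec w c s k t \<Longrightarrow> exec w d t l u \<Longrightarrow> exec w (Seq c d) s (k + l) u"
| Cond_True: "0 < val e s \<Longrightarrow> exec w c s k t
    \<Longrightarrow> exec w (Cond e c d) s (expr_cost w e s + k) t"
| Cond_False: "\<not> 0 < val e s \<Longrightarrow> exec w d s k t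
    \<Longrightarrow> exec w (Cond e c d) s (expr_cost w e s + k) t"
| Loop_True: "0 < val e s \<Longrightarrow> exec w c s k t \<Longrightarrow> exec w (Loop e c) t l u
    \<Longrightarrow> exec w (Loop e c) s (expr_cost w e s + k + l) u"
| Loop_False: "\<not> 0 < val e s \<Longrightarrow> exec w (Loop e c) s (expr_cost w e s) s"
| Call: "exec w c (init_store (map (\<lambda>e. val e s) es)) k t
    \<Longrightarrow> exec w (Call a i c es) s
          (expr_cost w i s + sum_list (map (\<lambda>e. expr_cost w e s) es) + k + num_words w (result t))
          (store_update s a (val i s) (result t))"

text \<open>Final store and cost are determined by the program and the initial store.\<close>

lemma exec_deterministic:
  assumes "exec w c s k t" and "exec w c s l u"
  shows "k = l \<and> t = u"
  using assms
proof (induction arbitrary: l u rule: exec.induct)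
  case (Seq c s k t d l' u')
  from Seq.prems show ?case by (cases rule: exec.cases) (auto dest!: Seq.IH)
next
  case (Cond_True e s c k t d)
  from Cond_True.prems show ?case
    using Cond_True.hyps by (cases rule: exec.cases) (auto dest!: Cond_True.IH)
next
  case (Cond_False e s d k t c)
  from Cond_False.prems show ?case
    using Cond_False.hyps by (cases rule: exec.cases) (auto dest!: Cond_False.IH)
next
  case (Loop_True e s c k t l' u')
  from Loop_True.prems show ?case
    using Loop_True.hyps by (cases rule: exec.cases) (auto dest!: Loop_True.IH)
next
  case (Loop_False e s c)
  from Loop_False.prems show ?case using Loop_False.hyps by (cases rule: exec.cases) auto
next
  case (Call c s es k t a i)
  from Call.prems show ?case by (cases rule: exec.cases) (auto dest!: Call.IH)
qed (auto elim: exec.cases)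

text \<open>On the inputs \<open>xs\<close>, the program \<open>P\<close> halts with output \<open>y\<close> after \<open>k\<close> word operations.\<close>

definition computes :: "nat \<Rightarrow> program \<Rightarrow> int list \<Rightarrow> int \<Rightarrow> nat \<Rightarrow> bool"
  where "computes w P xs y k \<longleftrightarrow> (\<exists>t. exec w P (init_store xs) k t \<and> result t = y)"

text \<open>
  The domain of \<open>M\<close> is the positive integers; the value at 0 is irrelevant. There is one
  multiplication algorithm for all \<open>n\<close>.
\<close>

definition multiplication_time :: "nat \<Rightarrow> (nat \<Rightarrow> real) \<Rightarrow> bool"
  where "multiplication_time w M \<longleftrightarrow>
    (\<forall>n\<ge>1. 0 < M n) \<and>
    (\<exists>P. \<forall>n\<ge>1. \<forall>x y. bit_length x \<le> n \<longrightarrow> bit_length y \<le> n \<longrightarrow>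
      (\<exists>k. computes w P [x, y] (x * y) k \<and> real k \<le> M n))"


section \<open>The arithmetic property\<close>

definition two_prime_numbers :: "nat set"  (\<open>\<T>\<close>)
  where "\<T> = {N. 0 < N \<and> 2 \<le> card (prime_factors N)}"

definition proper_divisor :: "nat \<Rightarrow> nat \<Rightarrow> bool"
  where "proper_divisor d N \<longleftrightarrow> d dvd N \<and> d \<noteq> 1 \<and> d \<noteq> N"

definition roots_of_unity :: "('a, 'b) ring_scheme \<Rightarrow> nat \<Rightarrow> 'a set"
  where "roots_of_unity L m = {x \<in> carrier L. x [^]\<^bsub>L\<^esub> m = \<one>\<^bsub>L\<^esub>}"

definition natural_wrt :: "nat \<Rightarrow> nat \<Rightarrow> nat \<Rightarrow> int \<Rightarrow> bool"
  where "natural_wrt p q m a \<longleftrightarrow>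
    \<not> p dvd m \<and>
    (let L = field.alg_closure (residue_ring (int q)); b = [a] \<cdot>\<^bsub>L\<^esub> \<one>\<^bsub>L\<^esub> in
      \<exists>x \<in> roots_of_unity L m. \<exists>y \<in> roots_of_unity L m.
        (x [^]\<^bsub>L\<^esub> p) \<oplus>\<^bsub>L\<^esub> (y [^]\<^bsub>L\<^esub> p) = b \<and> x \<oplus>\<^bsub>L\<^esub> y \<noteq> b)"

text \<open>
  Since \<open>q\<close> divides \<open>N\<close>, the property depends only on the residue class of \<open>a\<close> modulo \<open>N\<close>. An algorithm
  with a cost bound independent of the size of \<open>a\<close> is therefore given \<open>a mod N\<close> as its input.
\<close>

definition natural_property :: "nat \<Rightarrow> nat \<Rightarrow> int \<Rightarrow> bool"
  where "natural_property N m a \<longleftrightarrow>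
    N \<in> \<T> \<and> m \<ge> 3 \<and>
    (\<exists>p \<in> prime_factors N. \<exists>q \<in> prime_factors N. p \<noteq> q \<and> natural_wrt p q m a)"

end

theory Submission
  imports Defs "HOL-Computational_Algebra.Polynomial"
begin

text \<open>
  If \<open>u\<close> and \<open>v\<close> are the \<open>p\<close>-th powers of the two roots of unity and \<open>s p \<equiv> 1 (mod m)\<close>, the property
  of \<open>N\<close> says that over \<open>F\<^sub>q\<close> the polynomials \<open>X^m - 1\<close> and \<open>(a - X)^m - 1\<close> have a common root \<open>u\<close>
  at which \<open>h\<^sub>s = X^s + (a - X)^s - a\<close> does not vanish. Over \<open>F\<^sub>p\<close>, however, \<open>h\<^sub>s\<close> lies in the ideal of
  these two polynomials: modulo that ideal \<open>h\<^sub>s^p = X + (a - X) - a = 0\<close>, and a power of the Frobenius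
  map is the identity because \<open>X^m = 1\<close> and \<open>p\<close> does not divide \<open>m\<close>. So compute the gcd \<open>g\<close> of the two
  polynomials modulo \<open>N\<close> and reduce \<open>h\<^sub>1, \<dots>, h\<^sub>m\<close> modulo \<open>g\<close>. Either some leading coefficient in the
  Euclidean algorithm shares a factor with \<open>N\<close>, or for the right \<open>s\<close> all coefficients of the remainder
  of \<open>h\<^sub>s\<close> are divisible by \<open>p\<close> and some are not divisible by \<open>q\<close>.

  Going from \<open>(a - X)^s\<close> to \<open>(a - X)^(s+1)\<close> modulo \<open>g\<close> takes \<open>O(m)\<close> multiplications modulo \<open>N\<close>, so
  \<open>O(m^2)\<close> multiplications and gcds suffice. At this number even double-and-add multiplication and the
  binary gcd, with quadratic cost, meet the bound; of \<open>M\<close> one only needs \<open>M n \<ge> 1\<close>.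
\<close>

section \<open>Ideals of integer polynomials\<close>

text \<open>The primes \<open>p\<close> and \<open>q\<close> are unknown and the integers modulo
  \<open>N\<close> do not form a field, so nothing can be computed over F_p or F_q directly. What is
  proved about the computation is therefore phrased as membership in every ideal of Z[X] that
  contains \<open>N\<close>. Such statements are instantiated twice: at the ideal (\<open>p\<close>,
  F), where F is the gcd found and membership of a polynomial of small degree is read off from its
  coefficients, and at the kernel of evaluation at the root \<open>u\<close> in the closure of F_q,
  which the defect polynomial avoids. The program never constructs \<open>u\<close> or an extension
  field. One indeterminate suffices because the second power is a - u. The exponent \<open>s\<close>
  depends on the unknown \<open>p\<close>, which is why every exponent from 1 to \<open>m\<close> is
  tried. The gcd must have positive degree, for otherwise the constant 1, from which the powers are
  built up, would not be a remainder; a constant gcd is excluded by the property itself.\<close>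

definition poly_ideal :: "int poly set \<Rightarrow> bool"
  where "poly_ideal J \<longleftrightarrow> 0 \<in> J \<and> (\<forall>u v. u \<in> J \<longrightarrow> v \<in> J \<longrightarrow> u + v \<in> J) \<and> (\<forall>r u. u \<in> J \<longrightarrow> r * u \<in> J)"

lemma poly_ideal_zero: "poly_ideal J \<Longrightarrow> 0 \<in> J"
  and poly_ideal_add: "poly_ideal J \<Longrightarrow> u \<in> J \<Longrightarrow> v \<in> J \<Longrightarrow> u + v \<in> J"
  and poly_ideal_mult: "poly_ideal J \<Longrightarrow> u \<in> J \<Longrightarrow> r * u \<in> J"
  by (auto simp: poly_ideal_def)

lemma poly_ideal_smult: "poly_ideal J \<Longrightarrow> u \<in> J \<Longrightarrow> smult c u \<in> J"
  using poly_ideal_mult[of J u "[:c:]"] by simp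

lemma poly_ideal_uminus: "poly_ideal J \<Longrightarrow> u \<in> J \<Longrightarrow> - u \<in> J"
  using poly_ideal_mult[of J u "-1"] by simp

lemma poly_ideal_diff: "poly_ideal J \<Longrightarrow> u \<in> J \<Longrightarrow> v \<in> J \<Longrightarrow> u - v \<in> J"
  using poly_ideal_add[of J u "- v"] poly_ideal_uminus[of J v] by simp

lemma poly_ideal_const_dvd:
  assumes "poly_ideal J" "[:c:] \<in> J" "c dvd d"
  shows "[:d:] \<in> J"
  using assms poly_ideal_smult[of J "[:c:]"] by (auto elim!: dvdE simp: mult.commute)

lemma poly_ideal_coeffs_dvd:
  assumes "poly_ideal J" "[:c:] \<in> J" "\<And>i. c dvd coeff u i"
  shows "u \<in> J"
proof -
  have "[:c:] dvd u" using assms(3) by (simp add: const_poly_dvd_iff)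
  thus ?thesis using poly_ideal_mult[OF assms(1,2)] by (auto elim!: dvdE simp: mult.commute)
qed

lemma poly_ideal_smult_cancel:
  assumes "poly_ideal J" "[:n:] \<in> J" "coprime c n" "smult c u \<in> J"
  shows "u \<in> J"
proof -
  obtain x y where xy: "c * x + n * y = 1" using assms(3) by (metis bezout_int coprime_iff_gcd_eq_1 mult.commute)
  have "smult x (smult c u) + (smult y u) * [:n:] \<in> J"
    by (intro poly_ideal_add poly_ideal_smult poly_ideal_mult assms)
  also have "smult x (smult c u) + (smult y u) * [:n:] = smult (c * x + n * y) u"
    by (simp add: smult_add_left mult.commute)
  finally show ?thesis by (simp add: xy)
qed

lemma poly_ideal_sum: "poly_ideal J \<Longrightarrow> (\<And>i. i \<in> A \<Longrightarrow> f i \<in> J) \<Longrightarrow> sum f A \<in> J"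
  by (induction A rule: infinite_finite_induct) (auto simp: poly_ideal_zero poly_ideal_add)

lemma poly_ideal_power_diff:
  assumes "poly_ideal J" "u - v \<in> J"
  shows "u ^ n - v ^ n \<in> J"
proof (induction n)
  case 0 thus ?case using assms by (simp add: poly_ideal_zero)
next
  case (Suc n)
  have "u * (u ^ n - v ^ n) + v ^ n * (u - v) \<in> J"
    by (intro poly_ideal_add poly_ideal_mult Suc assms)
  thus ?case by (simp add: algebra_simps)
qed

lemma poly_ideal_freshman:
  assumes J: "poly_ideal J" "[:int p:] \<in> J" and p: "Factorial_Ring.prime p"
  shows "(u + v) ^ p - u ^ p - v ^ p \<in> J"
proof -
  have p0: "0 < p" using p prime_gt_0_nat by blast
  define f where "f k = of_nat (p choose k) * u ^ k * v ^ (p - k)" for k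
  have "(u + v) ^ p = (\<Sum>k\<le>p. f k)" unfolding f_def by (rule binomial_ring)
  also have "{..p} = insert p (insert 0 {0<..<p})" using p0 by auto
  also have "sum f \<dots> = f p + (f 0 + sum f {0<..<p})" using p0 by simp
  finally have "(u + v) ^ p - u ^ p - v ^ p = sum f {0<..<p}" by (simp add: f_def)
  moreover have "f k \<in> J" if "k \<in> {0<..<p}" for k
  proof -
    have "p dvd (p choose k)" using that p by (intro dvd_choose_prime) auto
    hence "[:int (p choose k):] \<in> J" by (intro poly_ideal_const_dvd[OF J]) simp
    hence "(u ^ k * v ^ (p - k)) * [:int (p choose k):] \<in> J" by (rule poly_ideal_mult[OF J(1)])
    thus ?thesis by (simp add: f_def of_nat_poly algebra_simps)
  qed
  hence "sum f {0<..<p} \<in> J" by (intro poly_ideal_sum J) auto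
  ultimately show ?thesis by simp
qed

lemma poly_ideal_freshman_iterate:
  assumes J: "poly_ideal J" "[:int p:] \<in> J" and p: "Factorial_Ring.prime p"
  shows "(u + v) ^ (p ^ t) - u ^ (p ^ t) - v ^ (p ^ t) \<in> J"
proof (induction t)
  case 0 thus ?case using J by (simp add: poly_ideal_zero)
next
  case (Suc t)
  let ?q = "p ^ t"
  have "(u + v) ^ ?q - (u ^ ?q + v ^ ?q) \<in> J" using Suc by (simp add: algebra_simps)
  from poly_ideal_add[OF J(1) poly_ideal_power_diff[OF J(1) this, of p]
      poly_ideal_freshman[OF assms, of "u ^ ?q" "v ^ ?q"]]
  have "((u + v) ^ ?q) ^ p - (u ^ ?q) ^ p - (v ^ ?q) ^ p \<in> J" by (simp only: diff_add_cancel diff_add_eq add_diff_eq)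
  thus ?case by (simp only: power_Suc2 power_mult)
qed

lemma fermat_int:
  fixes a :: int
  assumes p: "Factorial_Ring.prime p"
  shows "int p dvd a ^ p ^ t - a"
proof (induction t)
  case (Suc t)
  have *: "int p dvd b ^ p - b" for b :: int
  proof -
    \<comment> \<open>A natural representative of \<open>b\<close>, since
      \<open>fermat_theorem\<close> speaks of natural numbers.\<close>
    define n where "n = nat (b mod int p)"
    have p0: "0 < p" using p prime_gt_0_nat by blast
    have n: "[b = int n] (mod int p)" using p0 by (simp add: n_def cong_def)
    have "[n ^ p = n] (mod p)"
    proof (cases "p dvd n")
      case True
      thus ?thesis using p0 by (simp add: cong_def dvd_power_le mod_eq_0_iff_dvd dvd_trans[OF _ dvd_power])
    next
      case False
      from cong_scalar_right[OF fermat_theorem[OF p False], of n] show ?thesis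
        using p0 by (simp add: power_eq_if mult.commute)
    qed
    hence "[int n ^ p = int n] (mod int p)" by (metis cong_int_iff of_nat_power)
    with n have "[b ^ p = b] (mod int p)" by (meson cong_pow cong_sym cong_trans)
    thus ?thesis by (simp add: cong_iff_dvd_diff)
  qed
  have "a ^ p ^ Suc t - a = ((a ^ p ^ t) ^ p - a ^ p ^ t) + (a ^ p ^ t - a)"
    by (simp flip: power_mult add: mult.commute)
  thus ?case using *[of "a ^ p ^ t"] Suc by (metis dvd_add)
qed auto

text \<open>Modulo the ideal the power map is additive and multiplicative, fixes constants by Fermat
  and fixes X by assumption; every polynomial is built from these.\<close>

lemma poly_ideal_frobenius_fixes:
  assumes J: "poly_ideal J" "[:int p:] \<in> J" and p: "Factorial_Ring.prime p"
    and X: "monom 1 1 ^ (p ^ t) - monom 1 1 \<in> J"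
  shows "u ^ (p ^ t) - u \<in> J"
proof (induction u)
  case 0
  then show ?case using J prime_gt_0_nat[OF p] by (simp add: poly_ideal_zero zero_power)
next
  case (pCons c u)
  let ?q = "p ^ t" and ?X = "monom (1::int) 1"
  have eq: "pCons c u = [:c:] + ?X * u" by (simp add: monom_altdef)
  have "[:c:] ^ ?q - [:c:] \<in> J"
    using poly_ideal_const_dvd[OF J fermat_int[OF p, of c t]] by (simp add: poly_const_pow)
  moreover have "u ^ ?q * (?X ^ ?q - ?X) + ?X * (u ^ ?q - u) \<in> J"
    by (intro poly_ideal_add poly_ideal_mult J X pCons)
  moreover have "([:c:] + ?X * u) ^ ?q - [:c:] ^ ?q - (?X * u) ^ ?q \<in> J"
    by (rule poly_ideal_freshman_iterate[OF J p])
  ultimately have "(([:c:] + ?X * u) ^ ?q - [:c:] ^ ?q - (?X * u) ^ ?q) + (([:c:] ^ ?q - [:c:]) + (u ^ ?q * (?X ^ ?q - ?X) + ?X * (u ^ ?q - u))) \<in> J"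
    using poly_ideal_add[OF J(1)] by blast
  \<comment> \<open>The identity is stated for variables so that simplification does not expand the
    powers of the actual polynomials.\<close>
  moreover have "(h - c' - z) + ((c' - c) + (v * (x' - x) + x * (v - u))) = h - (c + x * u)"
    if "z = x' * v" for h c' z c v x' x u :: "int poly" using that by (simp add: algebra_simps)
  from this[OF power_mult_distrib] have "(([:c:] + ?X * u) ^ ?q - [:c:] ^ ?q - (?X * u) ^ ?q) + (([:c:] ^ ?q - [:c:]) + (u ^ ?q * (?X ^ ?q - ?X) + ?X * (u ^ ?q - u)))
    = ([:c:] + ?X * u) ^ ?q - ([:c:] + ?X * u)" .
  ultimately show ?case unfolding eq by (simp only:)
qed

text \<open>The polynomial \<open>h\<^sub>s\<close>.\<close>

definition power_sum_defect :: "int \<Rightarrow> nat \<Rightarrow> int poly"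
  where "power_sum_defect a s = monom 1 1 ^ s + [:a, -1:] ^ s - [:a:]"

lemma poly_ideal_power_cong_1:
  assumes J: "poly_ideal J" and u: "u ^ m - 1 \<in> J" and k: "[k = l] (mod m)"
  shows "u ^ k - u ^ l \<in> J"
proof -
  have *: "u ^ (m * j + r) - u ^ r \<in> J" for j r
  proof -
    have "u ^ r * ((u ^ m) ^ j - 1 ^ j) \<in> J"
      by (intro poly_ideal_mult J poly_ideal_power_diff u)
    moreover have "u ^ r * ((u ^ m) ^ j - 1 ^ j) = u ^ (m * j + r) - u ^ r"
      unfolding power_add power_mult by (simp add: right_diff_distrib mult.commute)
    ultimately show ?thesis by simp
  qed
  have "u ^ k - u ^ (k mod m) \<in> J" "u ^ l - u ^ (l mod m) \<in> J"
    using *[of "k div m" "k mod m"] *[of "l div m" "l mod m"] by simp_all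
  from poly_ideal_diff[OF J this] show ?thesis using k by (simp add: cong_def)
qed

lemma power_sum_defect_in_ideal:
  assumes J: "poly_ideal J" "[:int p:] \<in> J" and p: "Factorial_Ring.prime p" and m: "m \<ge> 1"
    and F: "monom 1 1 ^ m - 1 \<in> J" and G: "[:a, -1:] ^ m - 1 \<in> J"
    and s: "[s * p = 1] (mod m)"
  shows "power_sum_defect a s \<in> J"
proof -
  let ?X = "monom (1::int) 1" and ?Y = "[:a, -1:]" and ?h = "power_sum_defect a s"
  \<comment> \<open>By Euler's theorem \<open>p ^ t\<close> is 1 modulo \<open>m\<close>, and X^m =
    1 modulo \<open>J\<close>. This is the iterate of Frobenius that fixes X and hence
    everything.\<close>
  define t where "t = totient m"
  have t: "t > 0" using m by (simp add: t_def)
  have cop: "coprime p m" using s by (metis cong_solve_coprime_nat coprime_iff_invertible_nat mult.commute One_nat_def)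
  have pt: "[p ^ t = 1] (mod m)" unfolding t_def using cop by (rule euler_theorem)
  let ?c = "[:-a:]"
  have h: "?h = ?X ^ s + (?Y ^ s + ?c)" by (simp add: power_sum_defect_def)
  have f1: "?h ^ p - (?X ^ s) ^ p - (?Y ^ s + ?c) ^ p \<in> J" unfolding h by (rule poly_ideal_freshman[OF J p])
  have f2: "(?Y ^ s + ?c) ^ p - (?Y ^ s) ^ p - ?c ^ p \<in> J" by (rule poly_ideal_freshman[OF J p])
  have f3: "(?X ^ s) ^ p - ?X \<in> J" using poly_ideal_power_cong_1[OF J(1) F s] by (simp only: power_mult power_one_right)
  have f4: "(?Y ^ s) ^ p - ?Y \<in> J" using poly_ideal_power_cong_1[OF J(1) G s] by (simp only: power_mult power_one_right)
  have f5: "?c ^ p - ?c \<in> J" 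
    using poly_ideal_const_dvd[OF J fermat_int[OF p, of "-a" 1]] by (simp add: poly_const_pow)
  have alg: "(h - x - z) + ((z - y - c) + ((x - x') + ((y - y') + (c - c')))) = h - (x' + (y' + c'))"
    for h x y z c x' y' c' :: "int poly" by simp
  have "(?h ^ p - (?X ^ s) ^ p - (?Y ^ s + ?c) ^ p) + (((?Y ^ s + ?c) ^ p - (?Y ^ s) ^ p - ?c ^ p)
     + (((?X ^ s) ^ p - ?X) + (((?Y ^ s) ^ p - ?Y) + (?c ^ p - ?c)))) \<in> J"
    by (intro poly_ideal_add J f1 f2 f3 f4 f5)
  hence "?h ^ p - (?X + (?Y + ?c)) \<in> J" by (simp only: alg)
  also have "?X + (?Y + ?c) = 0" by (simp add: monom_altdef)
  finally have "?h ^ p \<in> J" by simp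
  hence "?h ^ (p ^ t - p) * ?h ^ p \<in> J" by (rule poly_ideal_mult[OF J(1)])
  \<comment> \<open>Positivity of \<open>t\<close> makes the \<open>p ^ t\<close>-th power a
    multiple of the \<open>p\<close>-th power, which is already in \<open>J\<close>.\<close>
  moreover have "p \<le> p ^ t" using t p by (simp add: self_le_power prime_gt_0_nat Suc_leI)
  ultimately have "?h ^ (p ^ t) \<in> J" by (simp flip: power_add)
  moreover have "?h ^ (p ^ t) - ?h \<in> J"
    by (rule poly_ideal_frobenius_fixes[OF J p]) (use poly_ideal_power_cong_1[OF J(1) F pt] in \<open>simp only: power_one_right\<close>)
  ultimately show ?thesis using poly_ideal_diff[OF J(1), of "?h ^ (p ^ t)"] by fastforce
qed

text \<open>Modulo \<open>p\<close> the degree of \<open>F\<close> is exactly \<open>d\<close>, so a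
  multiple of \<open>F\<close> of smaller degree must be 0. If \<open>k\<close> were the last index
  at which \<open>B\<close> survives modulo \<open>p\<close>, the product would have a nonzero
  coefficient at \<open>d + k\<close>.\<close>

lemma coeffs_dvd_of_mult_unit_lead:
  fixes F B H :: "int poly"
  assumes p: "Factorial_Ring.prime p" and F: "\<And>i. i > d \<Longrightarrow> coeff F i = 0" and lc: "\<not> p dvd coeff F d"
    and H: "\<And>i. i \<ge> d \<Longrightarrow> coeff H i = 0" and eq: "H = smult p A + F * B"
  shows "p dvd coeff H i"
proof -
  have B: "p dvd coeff B j" for j
  proof (rule ccontr)
    assume "\<not> p dvd coeff B j"
    define S where "S = {j. \<not> p dvd coeff B j}"
    have fin: "finite S" 
      by (rule finite_subset[of _ "{..degree B}"]) (auto simp: S_def intro: le_degree)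
    have "S \<noteq> {}" using \<open>\<not> p dvd coeff B j\<close> by (auto simp: S_def)
    define k where "k = Max S"
    have k: "\<not> p dvd coeff B k" using Max_in[OF fin \<open>S \<noteq> {}\<close>] by (simp add: S_def k_def)
    have kl: "p dvd coeff B l" if "l > k" for l
      using Max_ge[OF fin, of l] that by (force simp: S_def k_def)
    have "coeff (F * B) (d + k) = (\<Sum>i\<le>d+k. coeff F i * coeff B (d + k - i))" by (simp add: coeff_mult)
    also have "\<dots> = coeff F d * coeff B k + (\<Sum>i\<in>{..d+k} - {d}. coeff F i * coeff B (d + k - i))"
      by (subst sum.remove[of _ d]) auto
    finally have e: "coeff (F * B) (d + k) = \<dots>" .
    have "p dvd (\<Sum>i\<in>{..d+k} - {d}. coeff F i * coeff B (d + k - i))"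
    proof (rule dvd_sum)
      fix i assume "i \<in> {..d+k} - {d}"
      thus "p dvd coeff F i * coeff B (d + k - i)" using F[of i] kl[of "d + k - i"] by (cases "i > d") auto
    qed
    moreover have "p dvd coeff (F * B) (d + k)"
    proof -
      have "coeff (F * B) (d + k) = - (p * coeff A (d + k))" using H[of "d+k"] unfolding eq by simp
      thus ?thesis by simp
    qed
    ultimately have "p dvd coeff F d * coeff B k" unfolding e by (simp add: dvd_add_left_iff)
    thus False using p lc k by (simp add: prime_dvd_mult_iff)
  qed
  have "[:p:] dvd B" using B by (simp add: const_poly_dvd_iff)
  then obtain C where "B = [:p:] * C" by (elim dvdE)
  hence "H = smult p (A + F * C)" using eq by (simp add: smult_add_right)
  thus ?thesis by simp
qed

section \<open>Evaluation of integer polynomials in a commutative ring\<close>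

text \<open>The program is described with the type \<open>int poly\<close>, the algebraic closure is
  a ring with a carrier set. This evaluation links the two, and its kernel will be the ideal
  attached to \<open>q\<close>.\<close>

definition int_poly_eval :: "('a, 'b) ring_scheme \<Rightarrow> 'a \<Rightarrow> int poly \<Rightarrow> 'a"
  where "int_poly_eval L u h =
    fold_coeffs (\<lambda>c r. [c] \<cdot>\<^bsub>L\<^esub> \<one>\<^bsub>L\<^esub> \<oplus>\<^bsub>L\<^esub> u \<otimes>\<^bsub>L\<^esub> r) h \<zero>\<^bsub>L\<^esub>"

context cring
begin

lemma int_embed_closed [simp]: "[(c::int)] \<cdot> \<one> \<in> carrier R"
  by (simp add: add.int_pow_closed)

lemma int_embed_add: "[(c + d :: int)] \<cdot> \<one> = [c] \<cdot> \<one> \<oplus> [d] \<cdot> \<one>"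
  by (simp add: add.int_pow_mult)

lemma int_embed_mult: "[(c * d :: int)] \<cdot> \<one> = [c] \<cdot> \<one> \<otimes> [d] \<cdot> \<one>"
  by (simp add: add_pow_ldistr_int add.int_pow_pow mult.commute)

lemma int_embed_0 [simp]: "[(0::int)] \<cdot> \<one> = \<zero>"
  by (simp add: add_pow_int_ge)

lemma int_poly_eval_0 [simp]: "int_poly_eval R u 0 = \<zero>"
  by (simp add: int_poly_eval_def)

lemma int_poly_eval_pCons:
  assumes "u \<in> carrier R"
  shows "int_poly_eval R u (pCons c h) = [c] \<cdot> \<one> \<oplus> u \<otimes> int_poly_eval R u h"
  using assms by (cases "c = 0 \<and> h = 0") (auto simp: int_poly_eval_def)

lemma int_poly_eval_closed [simp]: "u \<in> carrier R \<Longrightarrow> int_poly_eval R u h \<in> carrier R"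
  by (induction h) (simp_all add: int_poly_eval_pCons)

lemma int_poly_eval_add:
  assumes "u \<in> carrier R"
  shows "int_poly_eval R u (g + h) = int_poly_eval R u g \<oplus> int_poly_eval R u h"
proof (induction g h rule: poly_induct2)
  case (pCons c g d h)
  have "int_poly_eval R u g \<in> carrier R" "int_poly_eval R u h \<in> carrier R" using assms by simp_all
  thus ?case using assms pCons
    by (simp add: int_poly_eval_pCons int_embed_add r_distr a_ac)
qed (use assms in simp)

lemma int_poly_eval_smult:
  assumes "u \<in> carrier R"
  shows "int_poly_eval R u (smult c h) = [c] \<cdot> \<one> \<otimes> int_poly_eval R u h"
proof (induction h)
  case (pCons d h)
  have "int_poly_eval R u h \<in> carrier R" using assms by simp
  thus ?case using assms pCons
    by (simp add: int_poly_eval_pCons int_embed_mult r_distr m_ac)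
qed (use assms in simp)

lemma int_poly_eval_mult:
  assumes "u \<in> carrier R"
  shows "int_poly_eval R u (g * h) = int_poly_eval R u g \<otimes> int_poly_eval R u h"
proof (induction g)
  case (pCons c g)
  have "int_poly_eval R u g \<in> carrier R" "int_poly_eval R u h \<in> carrier R" using assms by simp_all
  thus ?case using assms pCons
    by (simp add: int_poly_eval_pCons int_poly_eval_add int_poly_eval_smult l_distr m_assoc)
qed (use assms in simp)

lemma int_poly_eval_const: "u \<in> carrier R \<Longrightarrow> int_poly_eval R u [:c:] = [c] \<cdot> \<one>"
  by (simp add: int_poly_eval_pCons)

lemma int_embed_1 [simp]: "[(1::int)] \<cdot> \<one> = \<one>"
  by (simp add: add_pow_int_ge)

lemma int_poly_eval_1: "u \<in> carrier R \<Longrightarrow> int_poly_eval R u 1 = \<one>"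
  using int_poly_eval_const[of u 1] by (simp add: one_pCons)

lemma int_poly_eval_power:
  "u \<in> carrier R \<Longrightarrow> int_poly_eval R u (h ^ n) = int_poly_eval R u h [^] n"
  by (induction n) (simp_all add: int_poly_eval_1 int_poly_eval_mult m_comm)

lemma int_poly_eval_diff_eq_0:
  assumes "u \<in> carrier R"
  shows "int_poly_eval R u (g - h) = \<zero> \<longleftrightarrow> int_poly_eval R u g = int_poly_eval R u h"
proof -
  have "int_poly_eval R u (g - h) \<in> carrier R" "int_poly_eval R u h \<in> carrier R" using assms by simp_all
  moreover have "int_poly_eval R u g = int_poly_eval R u (g - h) \<oplus> int_poly_eval R u h"
    using int_poly_eval_add[OF assms, of "g - h" h] by simp
  ultimately show ?thesis by (metis add.r_cancel_one' l_zero)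
qed

lemma poly_ideal_int_poly_eval_kernel:
  "u \<in> carrier R \<Longrightarrow> poly_ideal {h. int_poly_eval R u h = \<zero>}"
  by (simp add: poly_ideal_def int_poly_eval_add int_poly_eval_mult)

lemma int_embed_cong:
  assumes "[q] \<cdot> \<one> = \<zero>" "[a = b] (mod q)"
  shows "[(a::int)] \<cdot> \<one> = [b] \<cdot> \<one>"
proof -
  obtain k where "a = b + q * k" using assms(2) by (metis cong_iff_lin cong_sym)
  thus ?thesis using assms(1) by (simp add: int_embed_add int_embed_mult)
qed

lemma int_embed_is_nat: "[int n] \<cdot> \<one> = [n] \<cdot> \<one>"
  by (simp add: add_pow_int_ge)

lemma root_of_unity_pow_cong:
  fixes k l m :: nat
  assumes "x \<in> carrier R" "x [^] m = \<one>" "[k = l] (mod m)"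
  shows "x [^] k = x [^] l"
proof -
  have "x [^] k = x [^] (k mod m)" for k :: nat
  proof -
    have "x [^] k = x [^] (m * (k div m) + k mod m)" by simp
    also have "\<dots> = (x [^] m) [^] (k div m) \<otimes> x [^] (k mod m)"
      using assms(1) by (simp only: nat_pow_mult[symmetric] nat_pow_pow)
    finally show ?thesis using assms by simp
  qed
  thus ?thesis using assms(3) by (metis cong_def)
qed

end

text \<open>The embedding of the residue ring into its closure is a ring homomorphism and carries
  the vanishing of \<open>q\<close> times one over. Commutativity and this relation are what the
  later argument takes from the closure.\<close>

lemma residue_ring_alg_closure:
  assumes "Factorial_Ring.prime q" and L_def: "L = field.alg_closure (residue_ring (int q))"
  shows "cring L" and "[int q] \<cdot>\<^bsub>L\<^esub> \<one>\<^bsub>L\<^esub> = \<zero>\<^bsub>L\<^esub>"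
proof -
  let ?R = "residue_ring (int q)"
  interpret R: residues_prime q ?R
    using assms by unfold_locales simp_all
  have fieldR: "field ?R" by (rule R.is_field)
  define \<iota> :: "int \<Rightarrow> (int list \<times> nat) multiset \<Rightarrow> int" where "\<iota> = ring.indexed_const ?R"
  interpret L: field L
    using field.alg_closureE(1)[OF fieldR] by (simp add: algebraic_closure_def L_def)
  show "cring L" by (rule L.is_cring)
  have hom: "\<iota> \<in> ring_hom ?R L"
    using field.alg_closureE(2)[OF fieldR] by (simp add: L_def \<iota>_def)
  interpret h: ring_hom_ring ?R L \<iota>
    by (rule ring_hom_ringI2[OF field.is_ring[OF fieldR] L.is_ring hom])
  have e: "[n] \<cdot>\<^bsub>?R\<^esub> \<one>\<^bsub>?R\<^esub> = int n mod int q" for n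
  proof (induction n)
    case 0
    show ?case by (simp add: R.res_zero_eq)
  next
    case (Suc n)
    thus ?case by (simp add: R.res_add_eq R.res_one_eq add_pow_def nat_pow_def mod_simps add.commute)
  qed
  have h: "\<iota> ([n] \<cdot>\<^bsub>?R\<^esub> \<one>\<^bsub>?R\<^esub>) = [n] \<cdot>\<^bsub>L\<^esub> \<one>\<^bsub>L\<^esub>" for n :: nat
    by (induction n) simp_all
  have "[q] \<cdot>\<^bsub>L\<^esub> \<one>\<^bsub>L\<^esub> = \<iota> (\<zero>\<^bsub>?R\<^esub>)"
    unfolding h[symmetric] e by (simp add: R.res_zero_eq)
  thus "[int q] \<cdot>\<^bsub>L\<^esub> \<one>\<^bsub>L\<^esub> = \<zero>\<^bsub>L\<^esub>"
    by (metis L.int_embed_is_nat h.hom_zero)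
qed

text \<open>The ideal is the kernel of evaluation at \<open>u\<close>, the \<open>p\<close>-th power
  of \<open>x\<close>. As \<open>u\<close> and \<open>v\<close> add up to \<open>a\<close>, the
  polynomial \<open>[:b, -1:]\<close> takes the value \<open>v\<close>; \<open>b\<close> will be the
  residue of \<open>a\<close> that the program receives. One ideal serves all exponents
  \<open>s\<close>.\<close>

lemma natural_wrt_ideal:
  assumes q: "Factorial_Ring.prime q" and p: "Factorial_Ring.prime p"
    and nat: "natural_wrt p q m a" and ab: "[a = b] (mod int q)"
  obtains J where "poly_ideal J" "[:int q:] \<in> J" "monom 1 1 ^ m - 1 \<in> J" "[:b, -1:] ^ m - 1 \<in> J"
    "\<And>s. [s * p = 1] (mod m) \<Longrightarrow> power_sum_defect b s \<notin> J"
proof -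
  define L where "L = field.alg_closure (residue_ring (int q))"
  interpret L: cring L using residue_ring_alg_closure(1)[OF q L_def] .
  have q0: "[int q] \<cdot>\<^bsub>L\<^esub> \<one>\<^bsub>L\<^esub> = \<zero>\<^bsub>L\<^esub>" by (rule residue_ring_alg_closure(2)[OF q L_def])
  obtain x y where x: "x \<in> carrier L" "x [^]\<^bsub>L\<^esub> m = \<one>\<^bsub>L\<^esub>" and y: "y \<in> carrier L" "y [^]\<^bsub>L\<^esub> m = \<one>\<^bsub>L\<^esub>"
    and xy: "(x [^]\<^bsub>L\<^esub> p) \<oplus>\<^bsub>L\<^esub> (y [^]\<^bsub>L\<^esub> p) = [a] \<cdot>\<^bsub>L\<^esub> \<one>\<^bsub>L\<^esub>" "x \<oplus>\<^bsub>L\<^esub> y \<noteq> [a] \<cdot>\<^bsub>L\<^esub> \<one>\<^bsub>L\<^esub>"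
    using nat by (auto simp: natural_wrt_def Let_def roots_of_unity_def L_def)
  have ab: "[a] \<cdot>\<^bsub>L\<^esub> \<one>\<^bsub>L\<^esub> = [b] \<cdot>\<^bsub>L\<^esub> \<one>\<^bsub>L\<^esub>" by (rule L.int_embed_cong[OF q0 ab])
  define u where "u = x [^]\<^bsub>L\<^esub> p"
  define v where "v = y [^]\<^bsub>L\<^esub> p"
  define J where "J = {h. int_poly_eval L u h = \<zero>\<^bsub>L\<^esub>}"
  have u: "u \<in> carrier L" and v: "v \<in> carrier L" using x y by (simp_all add: u_def v_def)
  have evX: "int_poly_eval L u (monom 1 1) = u" using u by (simp add: monom_altdef L.int_poly_eval_pCons)
  have evY: "int_poly_eval L u [:b, -1:] = v"
  proof -
    have "int_poly_eval L u ([:b, -1:] + monom 1 1) = [b] \<cdot>\<^bsub>L\<^esub> \<one>\<^bsub>L\<^esub>"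
      using L.int_poly_eval_const[OF u, of b] by (simp add: monom_altdef)
    hence "int_poly_eval L u [:b, -1:] \<oplus>\<^bsub>L\<^esub> u = v \<oplus>\<^bsub>L\<^esub> u"
      using xy(1) u v evX by (simp add: L.int_poly_eval_add ab L.a_comm flip: u_def v_def)
    thus ?thesis using u v by (metis L.add.right_cancel L.int_poly_eval_closed)
  qed
  have um: "u [^]\<^bsub>L\<^esub> m = \<one>\<^bsub>L\<^esub>" and vm: "v [^]\<^bsub>L\<^esub> m = \<one>\<^bsub>L\<^esub>"
    using x y unfolding u_def v_def by (metis L.nat_pow_pow L.nat_pow_one mult.commute)+
  show thesis
  proof (rule that[of J])
    show "poly_ideal J" unfolding J_def by (rule L.poly_ideal_int_poly_eval_kernel[OF u])
    show "[:int q:] \<in> J" using u q0 by (simp add: J_def L.int_poly_eval_const)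
    show "monom 1 1 ^ m - 1 \<in> J" 
      using um by (simp only: J_def mem_Collect_eq L.int_poly_eval_diff_eq_0[OF u] L.int_poly_eval_power[OF u] evX L.int_poly_eval_1[OF u])
    show "[:b, -1:] ^ m - 1 \<in> J"
      using vm by (simp only: J_def mem_Collect_eq L.int_poly_eval_diff_eq_0[OF u] L.int_poly_eval_power[OF u] evY L.int_poly_eval_1[OF u])
    fix s assume s: "[s * p = 1] (mod m)"
    \<comment> \<open>On \<open>m\<close>-th roots of unity, raising to the power \<open>s\<close>
      undoes raising to the power \<open>p\<close>; the defect thus takes the value x + y -
      a.\<close>
    have us: "u [^]\<^bsub>L\<^esub> s = x" "v [^]\<^bsub>L\<^esub> s = y"
      using L.root_of_unity_pow_cong[OF x s] L.root_of_unity_pow_cong[OF y s] x y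
      unfolding u_def v_def by (simp_all add: L.nat_pow_pow mult.commute)
    show "power_sum_defect b s \<notin> J"
      using xy(2) us unfolding ab
      by (simp only: power_sum_defect_def J_def mem_Collect_eq L.int_poly_eval_diff_eq_0[OF u]
         L.int_poly_eval_add[OF u] L.int_poly_eval_power[OF u] evX evY L.int_poly_eval_const[OF u] not_False_eq_True)
  qed
qed

section \<open>From ideals to a coefficient that splits N\<close>

lemma poly_ideal_generated:
  fixes n :: int and F :: "int poly"
  assumes J_def: "J = {h. \<exists>A B. h = smult n A + F * B}"
  shows "poly_ideal J" and "[:n:] \<in> J" and "F \<in> J"
proof -
  show "poly_ideal J" unfolding poly_ideal_def
  proof (intro conjI allI impI)
    show "0 \<in> J" unfolding J_def by (intro CollectI exI[of _ 0]) simp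
    fix u v assume "u \<in> J" "v \<in> J"
    then obtain A B C D where "u = smult n A + F * B" "v = smult n C + F * D" by (auto simp: J_def)
    hence "u + v = smult n (A + C) + F * (B + D)" by (simp add: algebra_simps smult_add_right)
    thus "u + v \<in> J" unfolding J_def by blast
  next
    fix r u assume "u \<in> J"
    then obtain A B where "u = smult n A + F * B" by (auto simp: J_def)
    hence "r * u = smult n (r * A) + F * (r * B)" by (simp add: algebra_simps)
    thus "r * u \<in> J" unfolding J_def by blast
  qed
  show "[:n:] \<in> J" unfolding J_def by (intro CollectI exI[of _ 1] exI[of _ 0]) simp
  show "F \<in> J" unfolding J_def by (intro CollectI exI[of _ 0] exI[of _ 1]) simp
qed

text \<open>Ideals that contain \<open>N\<close> stand for ideals modulo \<open>N\<close>, and ideals modulo \<open>p\<close> and \<open>q\<close> are among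
  them.\<close>

definition same_ideal :: "int \<Rightarrow> nat \<Rightarrow> int \<Rightarrow> int poly \<Rightarrow> int poly \<Rightarrow> bool"
  where "same_ideal N m a F G \<longleftrightarrow> (\<forall>J. poly_ideal J \<longrightarrow> [:N:] \<in> J \<longrightarrow>
    (F \<in> J \<and> G \<in> J \<longleftrightarrow> monom 1 1 ^ m - 1 \<in> J \<and> [:a, -1:] ^ m - 1 \<in> J))"

text \<open>The inverse of \<open>p\<close> is taken in the range 1 to \<open>m\<close> that the
  search scans. It is not 0, because 0 and 1 differ modulo \<open>m\<close>.\<close>

lemma natural_property_inverse:
  assumes "natural_property N m a"
  obtains p q s where "Factorial_Ring.prime p" "Factorial_Ring.prime q" "p dvd N" "q dvd N" "natural_wrt p q m a" 
    "[s * p = 1] (mod m)" "1 \<le> s" "s \<le> m"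
proof -
  from assms obtain p q where pq: "p \<in> prime_factors N" "q \<in> prime_factors N" "natural_wrt p q m a" and m: "m \<ge> 3"
    by (auto simp: natural_property_def)
  have p: "Factorial_Ring.prime p" and "\<not> p dvd m" using pq by (auto simp: natural_wrt_def)
  hence "coprime p m" by (rule prime_imp_coprime)
  then obtain t where t: "[p * t = 1] (mod m)" using cong_solve_coprime_nat by auto
  define s where "s = t mod m"
  have s: "[s * p = 1] (mod m)" using t unfolding s_def cong_def by (simp only: mod_mult_right_eq mult.commute)
  have "s \<noteq> 0" using s m by (intro notI) (simp add: cong_def)
  moreover have "s \<le> m" using m by (simp add: s_def)
  ultimately show thesis using that[of p q s] pq p s by auto
qed

text \<open>\<open>H\<close> stands for a remainder of the defect modulo \<open>F\<close>, up to a
  factor \<open>c\<close> invertible modulo \<open>N\<close>. The exponent is chosen before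
  \<open>H\<close> and \<open>c\<close>, since it depends on \<open>p\<close> only while the program
  supplies the other two. The ideal (\<open>p\<close>, \<open>F\<close>) forces \<open>p\<close>
  into all coefficients of \<open>H\<close>, the ideal at \<open>q\<close> keeps \<open>q\<close>
  out of one of them.\<close>

lemma exists_separating_coeff:
  assumes nat: "natural_property N m a" and ab: "[a = b] (mod int N)"
    and F: "\<And>i. i > d \<Longrightarrow> coeff F i = 0" and lc: "coprime (coeff F d) (int N)"
    and FJ: "same_ideal (int N) m b F 0"
  obtains s where "1 \<le> s" "s \<le> m"
    "\<And>H c. coprime c (int N) \<Longrightarrow> (\<And>i. i \<ge> d \<Longrightarrow> coeff H i = 0) \<Longrightarrow>
      (\<And>J. poly_ideal J \<Longrightarrow> [:int N:] \<in> J \<Longrightarrow> F \<in> J \<Longrightarrow> H - smult c (power_sum_defect b s) \<in> J) \<Longrightarrow>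
      \<exists>i. gcd (coeff H i) (int N) \<noteq> 1 \<and> \<not> int N dvd coeff H i"
proof -
  obtain p q s where p: "Factorial_Ring.prime p" and q: "Factorial_Ring.prime q" and pN: "p dvd N" and qN: "q dvd N"
    and pq: "natural_wrt p q m a" and s: "[s * p = 1] (mod m)" "1 \<le> s" "s \<le> m"
    using natural_property_inverse[OF nat] by blast
  have m: "m \<ge> 1" using s by simp
  show thesis
  proof (rule that[OF s(2,3)])
    fix H c assume c: "coprime c (int N)" and Hd: "\<And>i. i \<ge> d \<Longrightarrow> coeff H i = 0"
      and HJ: "\<And>J. poly_ideal J \<Longrightarrow> [:int N:] \<in> J \<Longrightarrow> F \<in> J \<Longrightarrow> H - smult c (power_sum_defect b s) \<in> J"
    \<comment> \<open>The ideal generated by \<open>p\<close> and \<open>F\<close>, on the side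
      where the defect vanishes.\<close>
    define J where "J = {h. \<exists>A B. h = smult (int p) A + F * B}"
    note J = poly_ideal_generated[OF J_def]
    have NJ: "[:int N:] \<in> J" using poly_ideal_const_dvd[OF J(1,2)] pN by simp
    have "power_sum_defect b s \<in> J"
      using FJ J NJ poly_ideal_zero[OF J(1)]
      by (intro power_sum_defect_in_ideal[OF J(1,2) p m _ _ s(1)]) (auto simp: same_ideal_def)
    hence "smult c (power_sum_defect b s) \<in> J" by (rule poly_ideal_smult[OF J(1)])
    from poly_ideal_add[OF J(1) HJ[OF J(1) NJ J(3)] this] have "H \<in> J" by simp
    then obtain A B where H: "H = smult (int p) A + F * B" by (auto simp: J_def)
    have "\<not> int p dvd coeff F d"
      using lc pN p by (metis coprime_common_divisor of_nat_dvd_iff not_prime_unit prime_nat_int_transfer)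
    hence pH: "int p dvd coeff H i" for i
      using p by (intro coeffs_dvd_of_mult_unit_lead[OF _ F _ Hd H]) auto
    \<comment> \<open>The kernel of evaluation, on the side where the defect survives.\<close>
    obtain K where K: "poly_ideal K" "[:int q:] \<in> K" "monom 1 1 ^ m - 1 \<in> K" "[:b, -1:] ^ m - 1 \<in> K"
      "power_sum_defect b s \<notin> K"
    proof (rule natural_wrt_ideal[OF q p pq])
      show "[a = b] (mod int q)" using ab qN by (metis cong_dvd_modulus of_nat_dvd_iff)
    qed (use s in blast)
    have NK: "[:int N:] \<in> K" using poly_ideal_const_dvd[OF K(1,2)] qN by simp
    have FK: "F \<in> K" using FJ K NK by (auto simp: same_ideal_def)
    have "H \<notin> K"
    proof
      assume "H \<in> K"
      from poly_ideal_diff[OF K(1) this HJ[OF K(1) NK FK]] have "smult c (power_sum_defect b s) \<in> K" by simp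
      from poly_ideal_smult_cancel[OF K(1) NK c this] K(5) show False by simp
    qed
    then obtain i where i: "\<not> int q dvd coeff H i" using poly_ideal_coeffs_dvd[OF K(1,2)] by blast
    have "\<not> int N dvd coeff H i" using i qN by (meson dvd_trans of_nat_dvd_iff)
    moreover have "gcd (coeff H i) (int N) \<noteq> 1"
      using pH[of i] pN p by (metis coprime_common_divisor coprime_iff_gcd_eq_1 of_nat_dvd_iff not_prime_unit prime_nat_int_transfer)
    ultimately show "\<exists>i. gcd (coeff H i) (int N) \<noteq> 1 \<and> \<not> int N dvd coeff H i" by blast
  qed
qed

text \<open>A constant \<open>F\<close> coprime to \<open>N\<close> generates everything together
  with \<open>N\<close>. Then \<open>H = 0\<close> would count as a remainder of the defect and
  would need a separating coefficient.\<close>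

lemma same_ideal_degree_pos:
  assumes nat: "natural_property N m a" and ab: "[a = b] (mod int N)"
    and F: "\<And>i. i > d \<Longrightarrow> coeff F i = 0" and lc: "coprime (coeff F d) (int N)"
    and FJ: "same_ideal (int N) m b F 0"
  shows "d > 0"
proof (rule ccontr)
  assume "\<not> d > 0"
  hence d: "d = 0" by simp
  obtain s where s: "\<And>H c. coprime c (int N) \<Longrightarrow> (\<And>i. i \<ge> d \<Longrightarrow> coeff H i = 0) \<Longrightarrow>
      (\<And>J. poly_ideal J \<Longrightarrow> [:int N:] \<in> J \<Longrightarrow> F \<in> J \<Longrightarrow> H - smult c (power_sum_defect b s) \<in> J) \<Longrightarrow>
      \<exists>i. gcd (coeff H i) (int N) \<noteq> 1 \<and> \<not> int N dvd coeff H i"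
    using exists_separating_coeff[OF assms] by metis
  have F': "F = [:coeff F 0:]" using F d by (auto simp: poly_eq_iff coeff_pCons split: nat.splits)
  have "\<exists>i. gcd (coeff 0 i) (int N) \<noteq> 1 \<and> \<not> int N dvd coeff 0 i"
  proof (rule s[of 1])
    fix J assume J: "poly_ideal J" "[:int N:] \<in> J" "F \<in> J"
    hence "smult (coeff F 0) 1 \<in> J" using F' by (simp add: one_pCons)
    from poly_ideal_smult_cancel[OF J(1,2) _ this] have "1 \<in> J" using lc d by blast
    hence "h \<in> J" for h using poly_ideal_mult[OF J(1), of 1 h] by simp
    thus "0 - smult 1 (power_sum_defect b s) \<in> J" .
  qed simp_all
  thus False by simp
qed

section \<open>Programs with bounded cost\<close>

fun nodes :: "expr \<Rightarrow> nat" where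
  "nodes (Lit c) = 1"
| "nodes (Get a i) = nodes i + 1"
| "nodes (Add e f) = nodes e + nodes f + 1"
| "nodes (Sub e f) = nodes e + nodes f + 1"
| "nodes (Shl e f) = nodes e + nodes f + 1"
| "nodes (Shr e f) = nodes e + nodes f + 1"

fun bounded :: "nat \<Rightarrow> expr \<Rightarrow> store \<Rightarrow> bool" where
  "bounded L (Lit c) s \<longleftrightarrow> \<bar>c\<bar> < 2 ^ L"
| "bounded L (Get a i) s \<longleftrightarrow> bounded L i s \<and> \<bar>s a (val i s)\<bar> < 2 ^ L"
| "bounded L (Add e f) s \<longleftrightarrow> bounded L e s \<and> bounded L f s \<and> \<bar>val e s + val f s\<bar> < 2 ^ L"
| "bounded L (Sub e f) s \<longleftrightarrow> bounded L e s \<and> bounded L f s \<and> \<bar>val e s - val f s\<bar> < 2 ^ L"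
| "bounded L (Shl e f) s \<longleftrightarrow> bounded L e s \<and> bounded L f s \<and> \<bar>val e s * 2 ^ nat (val f s)\<bar> < 2 ^ L"
| "bounded L (Shr e f) s \<longleftrightarrow> bounded L e s \<and> bounded L f s \<and> \<bar>val e s div 2 ^ nat (val f s)\<bar> < 2 ^ L"

text \<open>Counting bits instead of words makes all later bounds uniform in
  \<open>w\<close>.\<close>

lemma num_words_le:
  assumes "\<bar>x\<bar> < 2 ^ L"
  shows "num_words w x \<le> L + 1"
proof -
  have "nat \<bar>x\<bar> < 2 ^ L" using assms by (simp add: nat_less_iff)
  hence "bit_length x \<le> L" unfolding bit_length_def by (intro floorlog_leI) auto
  thus ?thesis unfolding num_words_def by (meson add_le_mono1 div_le_dividend le_trans)
qed

lemma expr_cost_le: "bounded L e s \<Longrightarrow> expr_cost w e s \<le> nodes e * (L + 1)"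
proof (induction e)
  case (Lit c)
  thus ?case using num_words_le[of c L w] by simp
next
  case (Get a i)
  thus ?case using num_words_le[of "s a (val i s)" L w] by (simp add: add_mult_distrib)
next
  case (Add e f)
  thus ?case using num_words_le[of "val e s + val f s" L w] by (simp add: add_mult_distrib)
next
  case (Sub e f)
  thus ?case using num_words_le[of "val e s - val f s" L w] by (simp add: add_mult_distrib)
next
  case (Shl e f)
  thus ?case using num_words_le[of "val e s * 2 ^ nat (val f s)" L w] by (simp add: add_mult_distrib)
next
  case (Shr e f)
  thus ?case using num_words_le[of "val e s div 2 ^ nat (val f s)" L w] by (simp add: add_mult_distrib)
qed

text \<open>Costs are counted in units of \<open>L + 1\<close>, which bounds the price of a node whose value has at most
  \<open>L\<close> bits.\<close>

definition runs :: "nat \<Rightarrow> nat \<Rightarrow> program \<Rightarrow> store \<Rightarrow> nat \<Rightarrow> (store \<Rightarrow> bool) \<Rightarrow> bool"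
  where "runs w L c s k Q \<longleftrightarrow> (\<exists>l t. exec w c s l t \<and> l \<le> k * (L + 1) \<and> Q t)"

section \<open>Rules for total correctness within a cost budget\<close>

lemma runs_mono: "runs w L c s k R \<Longrightarrow> k \<le> l \<Longrightarrow> (\<And>t. R t \<Longrightarrow> Q t) \<Longrightarrow> runs w L c s l Q"
  unfolding runs_def by (meson le_trans mult_le_mono1)

lemma runs_Skip: "Q s \<Longrightarrow> 1 \<le> k \<Longrightarrow> runs w L Skip s k Q"
  unfolding runs_def using exec.Skip[of w s] by (intro exI[of _ 1] exI[of _ s]) auto

lemma runs_Put:
  assumes "bounded L i s" "bounded L e s" "nodes i + nodes e \<le> k"
    and "Q (store_update s a (val i s) (val e s))"
  shows "runs w L (Put a i e) s k Q"
proof -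
  have "expr_cost w i s + expr_cost w e s \<le> (nodes i + nodes e) * (L + 1)"
    using expr_cost_le[OF assms(1), of w] expr_cost_le[OF assms(2), of w] by (simp add: add_mult_distrib)
  also have "\<dots> \<le> k * (L + 1)" using assms(3) by (rule mult_le_mono1)
  finally show ?thesis unfolding runs_def using exec.Put assms(4) by blast
qed

lemma runs_Seq:
  assumes "runs w L c s k R" "\<And>t. R t \<Longrightarrow> runs w L d t (l - k) Q" "k \<le> l"
  shows "runs w L (Seq c d) s l Q"
proof -
  obtain k' t where t: "exec w c s k' t" "k' \<le> k * (L + 1)" "R t" using assms(1) by (auto simp: runs_def)
  obtain l' u where u: "exec w d t l' u" "l' \<le> (l - k) * (L + 1)" "Q u"
    using assms(2)[OF t(3)] by (auto simp: runs_def)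
  have "k' + l' \<le> k * (L + 1) + (l - k) * (L + 1)" using t(2) u(2) by (rule add_mono)
  also have "\<dots> = l * (L + 1)" using assms(3) by (simp add: add_mult_distrib[symmetric] del: mult_Suc_right)
  finally show ?thesis unfolding runs_def using exec.Seq[OF t(1) u(1)] u(3) by blast
qed

lemma runs_Put_Seq:
  assumes "bounded L i s" "bounded L e s" "nodes i + nodes e \<le> k"
    and "runs w L d (store_update s a (val i s) (val e s)) (k - (nodes i + nodes e)) Q"
  shows "runs w L (Seq (Put a i e) d) s k Q"
  using assms
  by (intro runs_Seq[of w L _ s "nodes i + nodes e" "\<lambda>t. t = store_update s a (val i s) (val e s)"] runs_Put) auto

lemma runs_Skip_Seq: "runs w L d s (k - 1) Q \<Longrightarrow> 1 \<le> k \<Longrightarrow> runs w L (Seq Skip d) s k Q"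
  by (rule runs_Seq[of w L _ s 1 "\<lambda>t. t = s"]) (auto intro: runs_Skip)

text \<open>Nesting sequences to the right exposes their first command, which the rules ending in
  \<open>_Seq\<close> then execute symbolically.\<close>

lemma runs_Seq_assoc:
  assumes "runs w L (Seq c (Seq d e)) s k Q"
  shows "runs w L (Seq (Seq c d) e) s k Q"
proof -
  obtain l u where l: "exec w (Seq c (Seq d e)) s l u" "l \<le> k * (L + 1)" "Q u" using assms by (auto simp: runs_def)
  from l(1) obtain l1 l2 t where 1: "exec w c s l1 t" "exec w (Seq d e) t l2 u" "l = l1 + l2"
    by (auto elim: exec.cases)
  from 1(2) obtain l3 l4 v where 2: "exec w d t l3 v" "exec w e v l4 u" "l2 = l3 + l4"
    by (auto elim: exec.cases)
  have "exec w (Seq (Seq c d) e) s ((l1 + l3) + l4) u" by (rule exec.Seq[OF exec.Seq[OF 1(1) 2(1)] 2(2)])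
  thus ?thesis using l 1 2 unfolding runs_def by (metis add.assoc)
qed

lemma runs_Cond:
  assumes "bounded L e s" "nodes e \<le> k"
    and "0 < val e s \<Longrightarrow> runs w L c s (k - nodes e) Q" "\<not> 0 < val e s \<Longrightarrow> runs w L d s (k - nodes e) Q"
  shows "runs w L (Cond e c d) s k Q"
proof -
  have *: "expr_cost w e s + l \<le> k * (L + 1)" if "l \<le> (k - nodes e) * (L + 1)" for l
  proof -
    have "expr_cost w e s + l \<le> nodes e * (L + 1) + (k - nodes e) * (L + 1)"
      using expr_cost_le[OF assms(1), of w] that by (rule add_mono)
    also have "\<dots> = k * (L + 1)" using assms(2) by (simp add: add_mult_distrib[symmetric] del: mult_Suc_right)
    finally show ?thesis .
  qed
  show ?thesis
  proof (cases "0 < val e s")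
    case True
    with assms(3) obtain l t where "exec w c s l t" "l \<le> (k - nodes e) * (L + 1)" "Q t" by (auto simp: runs_def)
    thus ?thesis unfolding runs_def using exec.Cond_True[OF True] * by blast
  next
    case False
    with assms(4) obtain l t where "exec w d s l t" "l \<le> (k - nodes e) * (L + 1)" "Q t" by (auto simp: runs_def)
    thus ?thesis unfolding runs_def using exec.Cond_False[OF False] * by blast
  qed
qed

text \<open>The continuation is copied into both branches, so that no common postcondition of the
  branches has to be invented.\<close>

lemma runs_Cond_Seq:
  assumes "bounded L e s" "nodes e \<le> k"
    and "0 < val e s \<Longrightarrow> runs w L (Seq c f) s (k - nodes e) Q" "\<not> 0 < val e s \<Longrightarrow> runs w L (Seq d f) s (k - nodes e) Q"
  shows "runs w L (Seq (Cond e c d) f) s k Q"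
proof -
  have "runs w L (Cond e (Seq c f) (Seq d f)) s k Q" by (rule runs_Cond[OF assms])
  then obtain l u where l: "exec w (Cond e (Seq c f) (Seq d f)) s l u" "l \<le> k * (L + 1)" "Q u"
    by (auto simp: runs_def)
  have "exec w (Seq (Cond e c d) f) s l u"
    using l(1)
  proof (cases rule: exec.cases)
    case (Cond_True k)
    from Cond_True(3) obtain l1 l2 t where 1: "exec w c s l1 t" "exec w f t l2 u" "k = l1 + l2"
      by (auto elim: exec.cases)
    from exec.Seq[OF exec.Cond_True[OF Cond_True(2) 1(1), of d] 1(2)] show ?thesis
      using Cond_True 1 by (simp add: add.assoc)
  next
    case (Cond_False k)
    from Cond_False(3) obtain l1 l2 t where 1: "exec w d s l1 t" "exec w f t l2 u" "k = l1 + l2"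
      by (auto elim: exec.cases)
    from exec.Seq[OF exec.Cond_False[OF Cond_False(2) 1(1), of c] 1(2)] show ?thesis
      using Cond_False 1 by (simp add: add.assoc)
  qed
  thus ?thesis using l unfolding runs_def by blast
qed

text \<open>The index of the invariant bounds the number of iterations left; the loop may stop
  before it reaches 0. The additional \<open>nodes e\<close> pays for the last, failing
  test.\<close>

lemma runs_Loop:
  assumes inv: "I n s" and bd: "\<And>j t. I j t \<Longrightarrow> bounded L e t"
    and body: "\<And>j t. I j t \<Longrightarrow> 0 < val e t \<Longrightarrow> 0 < j \<and> runs w L c t k (I (j - 1))"
    and post: "\<And>j t. I j t \<Longrightarrow> \<not> 0 < val e t \<Longrightarrow> Q t"
    and cost: "n * (nodes e + k) + nodes e \<le> l"
  shows "runs w L (Loop e c) s l Q"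
proof -
  have "runs w L (Loop e c) s (n * (nodes e + k) + nodes e) Q"
    using inv
  proof (induction n arbitrary: s)
    case 0
    have "\<not> 0 < val e s" using body[OF 0] by blast
    thus ?case using exec.Loop_False[of e s w c] expr_cost_le[OF bd[OF 0], of w] post[OF 0]
      unfolding runs_def by auto
  next
    case (Suc n)
    show ?case
    proof (cases "0 < val e s")
      case True
      obtain l1 t where t: "exec w c s l1 t" "l1 \<le> k * (L + 1)" "I n t"
        using body[OF Suc.prems True] by (auto simp: runs_def)
      obtain l2 u where u: "exec w (Loop e c) t l2 u" "l2 \<le> (n * (nodes e + k) + nodes e) * (L + 1)" "Q u"
        using Suc.IH[OF t(3)] by (auto simp: runs_def)
      have "expr_cost w e s + l1 + l2 \<le> nodes e * (L + 1) + k * (L + 1) + (n * (nodes e + k) + nodes e) * (L + 1)"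
        using expr_cost_le[OF bd[OF Suc.prems], of w] t(2) u(2) by (intro add_mono)
      also have "\<dots> = (Suc n * (nodes e + k) + nodes e) * (L + 1)" by (simp add: algebra_simps)
      finally show ?thesis using exec.Loop_True[OF True t(1) u(1)] u(3) unfolding runs_def by blast
    next
      case False
      have "expr_cost w e s \<le> nodes e * (L + 1)" by (rule expr_cost_le[OF bd[OF Suc.prems]])
      also have "\<dots> \<le> (Suc n * (nodes e + k) + nodes e) * (L + 1)" by (intro mult_le_mono1) simp
      finally show ?thesis using exec.Loop_False[OF False] post[OF Suc.prems False] unfolding runs_def by blast
    qed
  qed
  thus ?thesis by (rule runs_mono) (use cost in auto)
qed

lemma runs_Call:
  assumes c: "runs w L c (init_store (map (\<lambda>e. val e s) es)) k (\<lambda>t. result t = r)"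
    and bd: "bounded L i s" "\<forall>e\<in>set es. bounded L e s" "\<bar>r\<bar> < 2 ^ L"
    and cost: "nodes i + sum_list (map nodes es) + 1 + k \<le> l"
    and Q: "Q (store_update s a (val i s) r)"
  shows "runs w L (Call a i c es) s l Q"
proof -
  obtain l1 t where t: "exec w c (init_store (map (\<lambda>e. val e s) es)) l1 t" "l1 \<le> k * (L + 1)" "result t = r"
    using c by (auto simp: runs_def)
  have "sum_list (map (\<lambda>e. expr_cost w e s) es) \<le> sum_list (map nodes es) * (L + 1)"
    using bd(2) by (induction es) (auto simp: algebra_simps dest!: expr_cost_le[of L _ s w] intro: add_mono)
  hence "expr_cost w i s + sum_list (map (\<lambda>e. expr_cost w e s) es) + l1 + num_words w (result t)
    \<le> nodes i * (L + 1) + sum_list (map nodes es) * (L + 1) + k * (L + 1) + (L + 1)"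
    using expr_cost_le[OF bd(1), of w] num_words_le[OF bd(3), of w] t by (intro add_mono) auto
  also have "\<dots> = (nodes i + sum_list (map nodes es) + 1 + k) * (L + 1)" by (simp add: algebra_simps)
  also have "\<dots> \<le> l * (L + 1)" using cost by (rule mult_le_mono1)
  finally show ?thesis unfolding runs_def using exec.Call[OF t(1), of a i] Q t(3) by blast
qed

lemma runs_Call_Seq:
  assumes "runs w L c (init_store (map (\<lambda>e. val e s) es)) k (\<lambda>t. result t = r)"
    and "bounded L i s" "\<forall>e\<in>set es. bounded L e s" "\<bar>r\<bar> < 2 ^ L"
    and "nodes i + sum_list (map nodes es) + 1 + k \<le> l"
    and "runs w L d (store_update s a (val i s) r) (l - (nodes i + sum_list (map nodes es) + 1 + k)) Q"
  shows "runs w L (Seq (Call a i c es) d) s l Q"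
proof (rule runs_Seq[where R = "\<lambda>t. t = store_update s a (val i s) r"])
  show "runs w L (Call a i c es) s (nodes i + sum_list (map nodes es) + 1 + k) (\<lambda>t. t = store_update s a (val i s) r)"
    by (rule runs_Call[OF assms(1-4) order_refl]) simp
qed (use assms(5,6) in auto)

lemma store_update_apply:
  "store_update s a i x b j = (if b = a \<and> j = i then x else s b j)"
  by (simp add: store_update_def)

lemma init_store_apply:
  "init_store xs a i = (if a = 0 \<and> 0 \<le> i \<and> i < int (length xs) then xs ! nat i else 0)"
  by (simp add: init_store_def)

section \<open>Modular multiplication and binary gcd\<close>

abbreviation reg :: "int \<Rightarrow> expr"
  where "reg c \<equiv> Get 0 (Lit c)"

abbreviation set_reg :: "int \<Rightarrow> expr \<Rightarrow> program"
  where "set_reg c e \<equiv> Put 0 (Lit c) e"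

abbreviation half :: "expr \<Rightarrow> expr"
  where "half e \<equiv> Shr e (Lit 1)"

abbreviation parity :: "expr \<Rightarrow> expr"
  where "parity e \<equiv> Sub e (Add (half e) (half e))"

text \<open>Cell 0 accumulates the product, cell 1 is the factor being doubled, cell 2 holds the
  unread bits of the other factor, cell 3 the modulus. Tests ask for positivity, hence the added 1
  in the comparisons with the modulus.\<close>

definition mulmod_body :: program
  where "mulmod_body =
    Seq (Cond (parity (reg 2))
          (Seq (set_reg 0 (Add (reg 0) (reg 1)))
               (Cond (Sub (Add (reg 0) (Lit 1)) (reg 3)) (set_reg 0 (Sub (reg 0) (reg 3))) Skip))
          Skip)
   (Seq (set_reg 2 (half (reg 2)))
   (Seq (set_reg 1 (Add (reg 1) (reg 1)))
        (Cond (Sub (Add (reg 1) (Lit 1)) (reg 3)) (set_reg 1 (Sub (reg 1) (reg 3))) Skip)))"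

definition mulmod :: program
  where "mulmod = Loop (reg 2) mulmod_body"

lemmas runs_intros = runs_Skip_Seq runs_Put_Seq runs_Seq_assoc runs_Cond_Seq runs_Skip runs_Put runs_Cond

definition mulmod_inv :: "int \<Rightarrow> int \<Rightarrow> nat \<Rightarrow> store \<Rightarrow> bool"
  where "mulmod_inv N z j s \<longleftrightarrow> s 0 3 = N \<and> 0 \<le> s 0 0 \<and> s 0 0 < N \<and> 0 \<le> s 0 1 \<and> s 0 1 < N \<and>
    0 \<le> s 0 2 \<and> s 0 2 < N \<and> s 0 2 < 2 ^ j \<and> N dvd s 0 0 + s 0 1 * s 0 2 - z"

lemma half_lt_power: "0 < j \<Longrightarrow> (y::int) < 2 ^ j \<Longrightarrow> y div 2 < 2 ^ (j - 1)"
  by (cases j) auto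

lemma mulmod_body_correct:
  assumes L: "16 * N < 2 ^ L" "64 \<le> (2::int) ^ L" and I: "mulmod_inv N z j s" and pos: "0 < s 0 2" "0 < j"
  shows "runs w L mulmod_body s 100 (mulmod_inv N z (j - 1))"
proof -
  define r x y h where "r = s 0 0" and "x = s 0 1" and "y = s 0 2" and "h = s 0 2 div 2"
  have I': "s 0 3 = N" "0 \<le> r" "r < N" "0 \<le> x" "x < N" "0 < y" "y < N" "y < 2 ^ j" "N dvd r + x * y - z"
    using I pos by (simp_all add: mulmod_inv_def r_def x_def y_def)
  have h: "h < 2 ^ (j - 1)" using half_lt_power[OF pos(2) I'(8)] by (simp add: h_def y_def)
  have y: "y = 2 * h \<or> y = 2 * h + 1" unfolding h_def y_def by presburger
  have h': "0 \<le> h" "h < N" using y I' by auto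
  have [simp]: "s 0 0 = r" "s 0 1 = x" "s 0 2 = y" "y div 2 = h" by (simp_all add: r_def x_def y_def h_def)
  have d: "N dvd r + x * y + N * c - z" for c
    using dvd_add[OF I'(9) dvd_triv_left[of N c]] by (simp add: algebra_simps)
  \<comment> \<open>The numbers \<open>b\<close> and \<open>c\<close>, each 0 or 1, record whether
    the modulus is subtracted after the doubling and after the addition.\<close>
  have even: "N dvd r + (x + x - N * b) * h - z" if "y = 2 * h" for b
    using d[of "- b * h"] that by (simp add: algebra_simps)
  have odd: "N dvd (r + x - N * c) + (x + x - N * b) * h - z" if "y = 2 * h + 1" for b c
    using d[of "- c - b * h"] that by (simp add: algebra_simps)
  show ?thesis
    using y
  proof
    assume y: "y = 2 * h"
    show ?thesis
      unfolding mulmod_body_def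
      by (intro runs_intros)
        (use L h h' y I' even[OF y, of 0] even[OF y, of 1] in \<open>simp_all add: store_update_apply mulmod_inv_def\<close>)
  next
    assume y: "y = 2 * h + 1"
    show ?thesis
      unfolding mulmod_body_def
      by (intro runs_intros)
        (use L h h' y I' odd[OF y, of 0 0] odd[OF y, of 0 1] odd[OF y, of 1 0] odd[OF y, of 1 1]
          in \<open>simp_all add: store_update_apply mulmod_inv_def\<close>)
  qed
qed

lemma mulmod_correct:
  assumes L: "16 * N < 2 ^ L" "64 \<le> (2::int) ^ L" and x: "0 \<le> x" "x < N" and y: "0 \<le> y" "y < N" "N < 2 ^ n"
  shows "runs w L mulmod (init_store [0, x, y, N]) (110 * n + 2) (\<lambda>t. result t = x * y mod N)"
  unfolding mulmod_def
proof (rule runs_Loop[where I = "mulmod_inv N (x * y)" and n = n and k = 100])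
  show "mulmod_inv N (x * y) n (init_store [0, x, y, N])"
    using x y by (simp add: mulmod_inv_def init_store_apply nat_numeral)
  fix j t assume I: "mulmod_inv N (x * y) j t"
  thus "bounded L (reg 2) t" using L by (simp add: mulmod_inv_def)
  {
    assume pos: "0 < val (reg 2) t"
    have "0 < j" using I pos by (cases j) (auto simp: mulmod_inv_def)
    thus "0 < j \<and> runs w L mulmod_body t 100 (mulmod_inv N (x * y) (j - 1))"
      using mulmod_body_correct[OF L I] pos by simp
  }
  assume "\<not> 0 < val (reg 2) t"
  hence "t 0 2 = 0" using I by (simp add: mulmod_inv_def)
  hence "N dvd t 0 0 - x * y" "0 \<le> t 0 0" "t 0 0 < N" using I by (simp_all add: mulmod_inv_def)
  thus "result t = x * y mod N" unfolding result_def
    by (metis mod_eq_dvd_iff mod_pos_pos_trivial)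
qed simp

text \<open>Cell 0 stays odd, so no power of two has to be restored in the gcd. It starts with the
  modulus, which is why even \<open>N\<close> is handled separately.\<close>

definition binary_gcd_body :: program
  where "binary_gcd_body =
    Seq (Cond (parity (reg 1))
          (Cond (Sub (reg 0) (reg 1))
            (Seq (set_reg 2 (reg 1)) (Seq (set_reg 1 (Sub (reg 0) (reg 1))) (set_reg 0 (reg 2))))
            (set_reg 1 (Sub (reg 1) (reg 0))))
          Skip)
        (set_reg 1 (half (reg 1)))"

definition binary_gcd :: program
  where "binary_gcd = Loop (reg 1) binary_gcd_body"

text \<open>The product of the two numbers is at least halved by every iteration.\<close>

definition binary_gcd_inv :: "int \<Rightarrow> int \<Rightarrow> nat \<Rightarrow> store \<Rightarrow> bool"
  where "binary_gcd_inv N z j s \<longleftrightarrow> 0 < s 0 0 \<and> s 0 0 \<le> N \<and> odd (s 0 0) \<and> 0 \<le> s 0 1 \<and> s 0 1 \<le> N \<and>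
    s 0 0 * s 0 1 < 2 ^ j \<and> gcd (s 0 0) (s 0 1) = z"

lemma gcd_odd_double: "odd (v::int) \<Longrightarrow> gcd v (2 * h) = gcd v h"
  by (metis gcd_mult_right_left_cancel coprime_right_2_iff_odd)

lemma binary_gcd_body_correct:
  assumes L: "16 * N < 2 ^ L" "64 \<le> (2::int) ^ L" and I: "binary_gcd_inv N z j s" and pos: "0 < s 0 1" "0 < j"
  shows "runs w L binary_gcd_body s 50 (binary_gcd_inv N z (j - 1))"
proof -
  define v u where "v = s 0 0" and "u = s 0 1"
  have [simp]: "s 0 0 = v" "s 0 1 = u" by (simp_all add: v_def u_def)
  have I': "0 < v" "v \<le> N" "odd v" "0 < u" "u \<le> N" "v * u < 2 ^ j" "gcd v u = z"
    using I pos by (simp_all add: binary_gcd_inv_def)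
  have j: "(2::int) ^ j = 2 * 2 ^ (j - 1)" using pos by (cases j) simp_all
  show ?thesis
  proof (cases "even u")
    case True
    then obtain h where h: "u = 2 * h" by (elim evenE)
    have "gcd v h = z" "v * h < 2 ^ (j - 1)" using I' j h by (simp_all add: gcd_odd_double)
    thus ?thesis
      unfolding binary_gcd_body_def
      by (intro runs_intros)
        (use L I' h in \<open>simp_all add: store_update_apply binary_gcd_inv_def\<close>)
  next
    case False
    hence par: "u - (u div 2 + u div 2) = 1" by presburger
    show ?thesis
    proof (cases "u < v")
      case True
      have "even (v - u)" using False I'(3) by simp
      then obtain h where h: "v - u = 2 * h" by (elim evenE)
      have "gcd u h = gcd u (v - u)" using False by (simp add: h gcd_odd_double)
      also have "\<dots> = z" using I'(7) by (metis gcd.commute gcd_diff1)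
      finally have g: "gcd u h = z" .
      have "2 * (u * h) = u * (v - u)" unfolding h by simp
      also have "\<dots> = u * v - u * u" by (rule right_diff_distrib)
      also have "\<dots> < 2 * 2 ^ (j - 1)" using I'(6) j mult_pos_pos[OF I'(4,4)] by (simp add: mult.commute)
      finally have "u * h < 2 ^ (j - 1)" by simp
      moreover have "(v - u) div 2 = h" using h by simp
      ultimately show ?thesis
        unfolding binary_gcd_body_def
        by (intro runs_intros)
          (use L I' h g par True False in \<open>simp_all add: store_update_apply binary_gcd_inv_def\<close>)
    next
      case ge: False
      have "even (u - v)" using False I'(3) by simp
      then obtain h where h: "u - v = 2 * h" by (elim evenE)
      have "gcd v h = gcd v (u - v)" using I'(3) by (simp add: h gcd_odd_double)
      also have "\<dots> = z" using I'(7) by (metis gcd.commute gcd_diff1)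
      finally have g: "gcd v h = z" .
      have "2 * (v * h) = v * (u - v)" unfolding h by simp
      also have "\<dots> = v * u - v * v" by (rule right_diff_distrib)
      also have "\<dots> < 2 * 2 ^ (j - 1)" using I'(6) j mult_pos_pos[OF I'(1,1)] by simp
      finally have "v * h < 2 ^ (j - 1)" by simp
      moreover have "(u - v) div 2 = h" using h by simp
      ultimately show ?thesis
        unfolding binary_gcd_body_def
        by (intro runs_intros)
          (use L I' h g par ge False in \<open>simp_all add: store_update_apply binary_gcd_inv_def\<close>)
    qed
  qed
qed

lemma binary_gcd_correct:
  assumes L: "16 * N < 2 ^ L" "64 \<le> (2::int) ^ L" and u: "0 \<le> u" "u \<le> N" and N: "odd N" "0 < N" "N < 2 ^ n"
  shows "runs w L binary_gcd (init_store [N, u]) (120 * n + 2) (\<lambda>t. result t = gcd u N)"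
  unfolding binary_gcd_def
proof (rule runs_Loop[where I = "binary_gcd_inv N (gcd u N)" and n = "2 * n" and k = 50])
  have "N * u < 2 ^ n * 2 ^ n" using u N by (intro mult_strict_mono') auto
  thus "binary_gcd_inv N (gcd u N) (2 * n) (init_store [N, u])"
    using u N by (simp add: binary_gcd_inv_def init_store_apply gcd.commute power_add mult_2)
  fix j t assume I: "binary_gcd_inv N (gcd u N) j t"
  thus "bounded L (reg 1) t" using L by (simp add: binary_gcd_inv_def)
  {
    assume pos: "0 < val (reg 1) t"
    have "0 < t 0 0 * t 0 1" using I pos by (simp add: binary_gcd_inv_def)
    hence "0 < j" using I by (cases j) (auto simp: binary_gcd_inv_def)
    thus "0 < j \<and> runs w L binary_gcd_body t 50 (binary_gcd_inv N (gcd u N) (j - 1))"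
      using binary_gcd_body_correct[OF L I] pos by simp
  }
  assume "\<not> 0 < val (reg 1) t"
  hence "t 0 1 = 0" using I by (simp add: binary_gcd_inv_def)
  thus "result t = gcd u N" using I by (auto simp: binary_gcd_inv_def result_def)
qed simp

section \<open>Polynomials modulo N as arrays\<close>

text \<open>Since the array is 0 at negative indices, entry \<open>i - k\<close> is always the coefficient of a shift
  by \<open>X^k\<close>.\<close>

definition coeff_array :: "int poly \<Rightarrow> int \<Rightarrow> int"
  where "coeff_array P j = (if j < 0 then 0 else coeff P (nat j))"

definition reduced :: "int \<Rightarrow> nat \<Rightarrow> int poly \<Rightarrow> bool"
  where "reduced N m P \<longleftrightarrow> (\<forall>i>m. coeff P i = 0) \<and> (\<forall>i. 0 \<le> coeff P i \<and> coeff P i < N)"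

lemma coeff_array_of_nat [simp]: "coeff_array P (int i) = coeff P i"
  by (simp add: coeff_array_def)

lemma coeff_array_inject: "coeff_array P = coeff_array Q \<longleftrightarrow> P = Q"
  by (metis coeff_array_of_nat poly_eqI)

lemma reduced_coeff_array:
  assumes "reduced N m P" "0 < N"
  shows "0 \<le> coeff_array P i" "coeff_array P i < N" "int m < i \<Longrightarrow> coeff_array P i = 0"
  using assms by (auto simp: reduced_def coeff_array_def)

text \<open>The later polynomial operations are instances: an elimination step; multiplication by x
  - y X, with both arguments equal and shift 1; a copy of \<open>Q\<close>, with x = 0, y = N - 1
  and shift 0.\<close>

definition lincomb_poly :: "int \<Rightarrow> nat \<Rightarrow> int \<Rightarrow> int \<Rightarrow> nat \<Rightarrow> int poly \<Rightarrow> int poly \<Rightarrow> int poly"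
  where "lincomb_poly N m x y k P Q = (\<Sum>i\<le>m. monom (coeff (smult x P - smult y (monom 1 k * Q)) i mod N) i)"

lemma coeff_lincomb_poly:
  "coeff (lincomb_poly N m x y k P Q) i = (if i \<le> m then (x * coeff P i - y * (if k \<le> i then coeff Q (i - k) else 0)) mod N else 0)"
proof -
  have "coeff (lincomb_poly N m x y k P Q) i = (\<Sum>j\<le>m. if i = j then coeff (smult x P - smult y (monom 1 k * Q)) j mod N else 0)"
    unfolding lincomb_poly_def coeff_sum by (intro sum.cong) auto
  thus ?thesis by (simp add: coeff_monom_mult)
qed

lemma coeff_array_lincomb_poly:
  "0 \<le> i \<Longrightarrow> i \<le> int m \<Longrightarrow> coeff_array (lincomb_poly N m x y k P Q) i = (x * coeff_array P i - y * coeff_array Q (i - int k)) mod N"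
  by (auto simp: coeff_array_def coeff_lincomb_poly nat_diff_distrib le_nat_iff nat_le_iff)

lemma reduced_lincomb_poly: "0 < N \<Longrightarrow> reduced N m (lincomb_poly N m x y k P Q)"
  by (simp add: reduced_def coeff_lincomb_poly)

text \<open>
  Cells of array 0: 0 \<open>N\<close>, 1 \<open>m\<close>, 2 \<open>a\<close>; 3, 4, 5 the scalars \<open>x\<close>, \<open>y\<close> and the shift \<open>k\<close> of a linear
  combination; 6 loop index; 7, 8 temporary; 9, 10 degree bounds of the Euclidean pair; 11 the divisor
  found (0 if none); 12 latest gcd; 13 loop counter. Arrays 1 and 2 hold the Euclidean pair, 3 is
  temporary; 4, 5, 6 hold multiples of \<open>(a - X)^s\<close>, \<open>X^s\<close>, 1 modulo the gcd; 7 holds the remainder of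
  \<open>h\<^sub>s\<close>; 8 holds the constant 1.

  The loop index decreases, so for \<open>A = B\<close> the entry \<open>i - k\<close> is still the old one.
\<close>

definition lincomb_body :: "nat \<Rightarrow> nat \<Rightarrow> program"
  where "lincomb_body A B =
    Seq (Call 0 (Lit 7) mulmod [Lit 0, reg 3, Get A (reg 6), reg 0])
   (Seq (Call 0 (Lit 8) mulmod [Lit 0, reg 4, Get B (Sub (reg 6) (reg 5)), reg 0])
   (Seq (set_reg 7 (Sub (reg 7) (reg 8)))
   (Seq (Cond (Sub (Lit 0) (reg 7)) (set_reg 7 (Add (reg 7) (reg 0))) Skip)
   (Seq (Put A (reg 6) (reg 7))
        (set_reg 6 (Sub (reg 6) (Lit 1)))))))"

definition lincomb_loop :: "nat \<Rightarrow> nat \<Rightarrow> program"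
  where "lincomb_loop A B = Seq (set_reg 6 (reg 1)) (Loop (Add (reg 6) (Lit 1)) (lincomb_body A B))"

definition lincomb_inv :: "store \<Rightarrow> nat \<Rightarrow> int poly \<Rightarrow> nat \<Rightarrow> nat \<Rightarrow> store \<Rightarrow> bool"
  where "lincomb_inv s A R m j t \<longleftrightarrow> t 0 6 = int j - 1 \<and> j \<le> m + 1 \<and>
    (\<forall>i. t A i = (if int j \<le> i then coeff_array R i else s A i)) \<and>
    (\<forall>b i. b \<noteq> A \<longrightarrow> \<not> (b = 0 \<and> i \<in> {6, 7, 8}) \<longrightarrow> t b i = s b i)"

text \<open>The machine has no division; one conditional addition normalizes the difference of two
  residues.\<close>

lemma mod_diff_if:
  fixes p q N :: int
  assumes "0 < N"
  shows "(p - q) mod N = (if p mod N - q mod N < 0 then p mod N - q mod N + N else p mod N - q mod N)"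
proof -
  have "(p - q) mod N = (p mod N - q mod N) mod N" by (simp add: mod_diff_eq)
  moreover have "- N < p mod N - q mod N" "p mod N - q mod N < N"
    using assms by (smt (verit) pos_mod_bound pos_mod_sign)+
  ultimately show ?thesis by (smt (verit) mod_add_self2 mod_pos_pos_trivial)
qed

lemma lincomb_body_correct:
  assumes L: "16 * N < 2 ^ L" "64 \<le> (2::int) ^ L" "16 * int m < 2 ^ L" and N: "0 < N" "N < 2 ^ n"
    and AB: "A \<noteq> 0" "B \<noteq> 0"
    and s: "s 0 0 = N" "s 0 1 = int m" "s 0 3 = x" "s 0 4 = y" "s 0 5 = int k" "s A = coeff_array P" "s B = coeff_array Q"
    and x: "0 \<le> x" "x < N" and y: "0 \<le> y" "y < N" and k: "k \<le> m"
    and P: "reduced N m P" and Q: "reduced N m Q"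
    and I: "lincomb_inv s A (lincomb_poly N m x y k P Q) m j t" and j: "0 < j"
  shows "runs w L (lincomb_body A B) t (220 * n + 100) (lincomb_inv s A (lincomb_poly N m x y k P Q) m (j - 1))"
proof -
  define i where "i = int j - 1"
  define R where "R = lincomb_poly N m x y k P Q"
  have t: "t 0 0 = N" "t 0 1 = int m" "t 0 3 = x" "t 0 4 = y" "t 0 5 = int k" "t 0 6 = i"
    using I s AB by (auto simp: lincomb_inv_def i_def)
  have i: "0 \<le> i" "i \<le> int m" using I j by (auto simp: lincomb_inv_def i_def)
  have tA: "t A i = coeff_array P i" using I s by (simp add: lincomb_inv_def i_def)
  have tB: "t B (i - int k) = coeff_array Q (i - int k)"
    using I s AB by (cases "A = B") (auto simp: lincomb_inv_def i_def)
  define p q where "p = x * coeff_array P i mod N" and "q = y * coeff_array Q (i - int k) mod N"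
  have pq: "0 \<le> p" "p < N" "0 \<le> q" "q < N" using N by (simp_all add: p_def q_def)
  note P' = reduced_coeff_array(1,2)[OF P N(1)] and Q' = reduced_coeff_array(1,2)[OF Q N(1)]
  have R: "coeff_array R i = (if p - q < 0 then p - q + N else p - q)"
    using coeff_array_lincomb_poly[OF i, of N x y k P Q] mod_diff_if[OF N(1)] by (simp add: R_def p_def q_def)
  have "int k < 2 ^ L" "\<bar>i - int k\<bar> < 2 ^ L" using i k L by linarith+
  hence k': "k < 2 ^ L" "\<bar>i - int k\<bar> < 2 ^ L" by simp_all
  let ?t1 = "store_update t 0 7 p"
  have call1: "runs w L mulmod (init_store (map (\<lambda>e. val e t) [Lit 0, reg 3, Get A (reg 6), reg 0])) (110 * n + 2) (\<lambda>u. result u = p)"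
    using mulmod_correct[OF L(1,2) x P'[of i] N(2), of w] by (simp add: t tA p_def)
  have call2: "runs w L mulmod (init_store (map (\<lambda>e. val e ?t1) [Lit 0, reg 4, Get B (Sub (reg 6) (reg 5)), reg 0])) (110 * n + 2) (\<lambda>u. result u = q)"
    using mulmod_correct[OF L(1,2) y Q'[of "i - int k"] N(2), of w] AB by (simp add: t tB q_def store_update_apply)
  have final: "lincomb_inv s A R m (j - 1) u"
    if "u 0 6 = i - 1" "u A = (t A)(i := coeff_array R i)" "\<And>b c. b \<noteq> A \<Longrightarrow> \<not> (b = 0 \<and> c \<in> {6,7,8}) \<Longrightarrow> u b c = t b c" for u
    using that I j by (auto simp: lincomb_inv_def i_def R_def[symmetric])
  show ?thesis
    unfolding lincomb_body_def R_def[symmetric]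
  proof (rule runs_Call_Seq[OF call1])
    show "runs w L (Seq (Call 0 (Lit 8) mulmod [Lit 0, reg 4, Get B (Sub (reg 6) (reg 5)), reg 0])
       (Seq (set_reg 7 (Sub (reg 7) (reg 8)))
       (Seq (Cond (Sub (Lit 0) (reg 7)) (set_reg 7 (Add (reg 7) (reg 0))) Skip)
       (Seq (Put A (reg 6) (reg 7)) (set_reg 6 (Sub (reg 6) (Lit 1)))))))
     (store_update t 0 (val (Lit 7) t) p)
     (220 * n + 100 - (nodes (Lit 7) + sum_list (map nodes [Lit 0, reg 3, Get A (reg 6), reg 0]) + 1 + (110 * n + 2)))
     (lincomb_inv s A R m (j - 1))"
      unfolding val.simps
    proof (rule runs_Call_Seq[OF call2])
      show "runs w L (Seq (set_reg 7 (Sub (reg 7) (reg 8)))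
       (Seq (Cond (Sub (Lit 0) (reg 7)) (set_reg 7 (Add (reg 7) (reg 0))) Skip)
       (Seq (Put A (reg 6) (reg 7)) (set_reg 6 (Sub (reg 6) (Lit 1))))))
       (store_update ?t1 0 (val (Lit 8) ?t1) q)
       (220 * n + 100 - (nodes (Lit 7) + sum_list (map nodes [Lit 0, reg 3, Get A (reg 6), reg 0]) + 1 + (110 * n + 2))
         - (nodes (Lit 8) + sum_list (map nodes [Lit 0, reg 4, Get B (Sub (reg 6) (reg 5)), reg 0]) + 1 + (110 * n + 2)))
       (lincomb_inv s A R m (j - 1))"
        by (intro runs_intros final,
          use L i pq AB R k in \<open>simp_all add: store_update_apply t fun_eq_iff split: if_splits\<close>) auto
    qed (use L i pq AB P'[of i] Q'[of "i - int k"] x y k' N in \<open>simp_all add: store_update_apply t tA tB\<close>)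
  qed (use L i pq AB P'[of i] x y k N in \<open>simp_all add: store_update_apply t tA tB\<close>)
qed

lemma nat_less_power: "16 * int m < 2 ^ L \<Longrightarrow> m < 2 ^ L"
proof -
  assume "16 * int m < 2 ^ L"
  hence "int m < 2 ^ L" by linarith
  thus ?thesis by simp
qed

lemma lincomb_loop_correct:
  assumes L: "16 * N < 2 ^ L" "64 \<le> (2::int) ^ L" "16 * int m < 2 ^ L" and N: "0 < N" "N < 2 ^ n"
    and AB: "A \<noteq> 0" "B \<noteq> 0"
    and s: "s 0 0 = N" "s 0 1 = int m" "s 0 3 = x" "s 0 4 = y" "s 0 5 = int k" "s A = coeff_array P" "s B = coeff_array Q"
    and x: "0 \<le> x" "x < N" and y: "0 \<le> y" "y < N" and k: "k \<le> m"
    and P: "reduced N m P" and Q: "reduced N m Q"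
  shows "runs w L (lincomb_loop A B) s ((m + 2) * (220 * n + 110))
    (\<lambda>t. t A = coeff_array (lincomb_poly N m x y k P Q) \<and> (\<forall>b i. b \<noteq> A \<longrightarrow> \<not> (b = 0 \<and> i \<in> {6, 7, 8}) \<longrightarrow> t b i = s b i))"
  unfolding lincomb_loop_def
proof (rule runs_Put_Seq)
  let ?R = "lincomb_poly N m x y k P Q"
  show "runs w L (Loop (Add (reg 6) (Lit 1)) (lincomb_body A B)) (store_update s 0 (val (Lit 6) s) (val (reg 1) s))
     ((m + 2) * (220 * n + 110) - (nodes (Lit 6) + nodes (reg 1)))
     (\<lambda>t. t A = coeff_array ?R \<and> (\<forall>b i. b \<noteq> A \<longrightarrow> \<not> (b = 0 \<and> i \<in> {6, 7, 8}) \<longrightarrow> t b i = s b i))"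
  proof (rule runs_Loop[where I = "lincomb_inv s A ?R m" and n = "m + 1" and k = "220 * n + 100"])
    \<comment> \<open>Both the old and the new polynomial vanish above \<open>m\<close>, so the
      array is already correct there.\<close>
    show "lincomb_inv s A ?R m (m + 1) (store_update s 0 (val (Lit 6) s) (val (reg 1) s))"
      using AB s N reduced_coeff_array(3)[OF P N(1)] reduced_coeff_array(3)[OF reduced_lincomb_poly[OF N(1)] N(1)]
      by (auto simp: lincomb_inv_def store_update_apply)
    fix j t assume I: "lincomb_inv s A ?R m j t"
    have "j \<le> m + 1" using I by (simp add: lincomb_inv_def)
    hence "int j < 2 ^ L" using L by linarith
    moreover from this have "\<bar>int j - 1\<bar> < 2 ^ L" using L by linarith
    ultimately have "j < 2 ^ L" "\<bar>int j - 1\<bar> < 2 ^ L" by simp_all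
    thus "bounded L (Add (reg 6) (Lit 1)) t" using I L by (simp add: lincomb_inv_def)
    {
      assume "0 < val (Add (reg 6) (Lit 1)) t"
      hence "0 < j" using I by (simp add: lincomb_inv_def)
      thus "0 < j \<and> runs w L (lincomb_body A B) t (220 * n + 100) (lincomb_inv s A ?R m (j - 1))"
        using lincomb_body_correct[OF L N AB s x y k P Q I] by blast
    }
    assume "\<not> 0 < val (Add (reg 6) (Lit 1)) t"
    hence "j = 0" using I by (simp add: lincomb_inv_def)
    \<comment> \<open>Negative indices are never written, and both arrays are 0 there.\<close>
    hence "t A = coeff_array ?R"
      using I s(6) by (auto simp: lincomb_inv_def fun_eq_iff coeff_array_def)
    thus "t A = coeff_array ?R \<and> (\<forall>b i. b \<noteq> A \<longrightarrow> \<not> (b = 0 \<and> i \<in> {6, 7, 8}) \<longrightarrow> t b i = s b i)"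
      using I by (simp add: lincomb_inv_def)
  qed (simp add: algebra_simps)
qed (use L nat_less_power[OF L(3)] s in simp_all)

text \<open>The assumption says that cutting off at \<open>m\<close> loses nothing; what remains is
  reduction of coefficients modulo \<open>N\<close>.\<close>

lemma lincomb_poly_cong:
  assumes "\<And>i. i > m \<Longrightarrow> coeff (smult x P - smult y (monom 1 k * Q)) i = 0"
  shows "[:N:] dvd lincomb_poly N m x y k P Q - (smult x P - smult y (monom 1 k * Q))" (is "_ dvd _ - ?E")
proof -
  have "N dvd coeff (lincomb_poly N m x y k P Q) i - coeff ?E i" for i
  proof (cases "i \<le> m")
    case True
    hence "coeff (lincomb_poly N m x y k P Q) i = coeff ?E i mod N"
      unfolding coeff_lincomb_poly by (simp add: coeff_monom_mult)
    thus ?thesis by (metis dvd_minus_mod dvd_minus_iff minus_diff_eq)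
  next
    case False
    thus ?thesis using assms[of i] by (simp add: coeff_lincomb_poly)
  qed
  thus ?thesis unfolding const_poly_dvd_iff by simp
qed

lemma poly_ideal_const_dvd_poly: "poly_ideal J \<Longrightarrow> [:N:] \<in> J \<Longrightarrow> [:N:] dvd P \<Longrightarrow> P \<in> J"
  using poly_ideal_mult[of J "[:N:]"] by (auto elim!: dvdE simp: mult.commute)

lemma lincomb_poly_in_ideal:
  assumes "poly_ideal J" "[:N:] \<in> J" "\<And>i. i > m \<Longrightarrow> coeff (smult x P - smult y (monom 1 k * Q)) i = 0"
  shows "lincomb_poly N m x y k P Q - (smult x P - smult y (monom 1 k * Q)) \<in> J"
  using poly_ideal_const_dvd_poly[OF assms(1,2) lincomb_poly_cong[OF assms(3)]] .

lemma lincomb_poly_copy: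
  assumes "reduced N m Q"
  shows "lincomb_poly N m 0 (N - 1) 0 P Q = Q"
proof (rule poly_eqI)
  fix i
  have "(0 * coeff P i - (N - 1) * coeff Q i) mod N = (coeff Q i + (- coeff Q i) * N) mod N"
    by (simp add: algebra_simps)
  also have "\<dots> = coeff Q i mod N" by (rule mod_mult_self1)
  also have "\<dots> = coeff Q i" using assms by (simp add: reduced_def)
  finally show "coeff (lincomb_poly N m 0 (N - 1) 0 P Q) i = coeff Q i"
    using assms by (simp add: coeff_lincomb_poly reduced_def)
qed

section \<open>Pairs of polynomials in the Euclidean algorithm\<close>

text \<open>Modulo every prime divisor of \<open>N\<close> the degree of \<open>F\<close> is exactly
  \<open>d\<close>, whereas \<open>e\<close> is only an upper bound for \<open>G\<close>. It is an
  integer so that -1 can express \<open>G = 0\<close>.\<close>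

definition euclid_pair :: "int \<Rightarrow> nat \<Rightarrow> int \<Rightarrow> nat \<Rightarrow> int \<Rightarrow> int poly \<Rightarrow> int poly \<Rightarrow> bool"
  where "euclid_pair N m a d e F G \<longleftrightarrow>
    (\<forall>i>d. coeff F i = 0) \<and> (\<forall>i. e < int i \<longrightarrow> coeff G i = 0) \<and> coprime (coeff F d) N \<and> same_ideal N m a F G"

lemma euclid_pair_swap:
  "euclid_pair N m a d (int e) F G \<Longrightarrow> coprime (coeff G e) N \<Longrightarrow> euclid_pair N m a e (int d) G F"
  by (auto simp: euclid_pair_def same_ideal_def)

text \<open>Cross-multiplication cancels the terms at \<open>e\<close>. It preserves the ideal
  because the factor put in front of \<open>G\<close> is coprime to \<open>N\<close> and can be
  cancelled again.\<close>

lemma euclid_pair_eliminate: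
  assumes FG: "euclid_pair N m a d (int e) F G" and "d \<le> e" "e \<le> m"
  shows "euclid_pair N m a d (int e - 1) F (lincomb_poly N m (coeff F d) (coeff G e) (e - d) G F)"
proof -
  let ?x = "coeff F d" and ?y = "coeff G e"
  let ?E = "smult ?x G - smult ?y (monom 1 (e - d) * F)" and ?H = "lincomb_poly N m ?x ?y (e - d) G F"
  have FG': "\<And>i. d < i \<Longrightarrow> coeff F i = 0" "\<And>i. e < i \<Longrightarrow> coeff G i = 0" "coprime ?x N" "same_ideal N m a F G"
    using FG by (auto simp: euclid_pair_def)
  have E: "coeff ?E i = 0" if "i \<ge> e" for i
    using that assms(2) FG'(1)[of "i - (e - d)"] FG'(2)[of i] by (cases "i = e") (auto simp: coeff_monom_mult)
  have "coeff ?H i = 0" if "i \<ge> e" for i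
    using E[OF that] by (simp add: coeff_lincomb_poly coeff_monom_mult)
  hence "\<forall>i. int e - 1 < int i \<longrightarrow> coeff ?H i = 0" by auto
  moreover have "same_ideal N m a F ?H"
    unfolding same_ideal_def
  proof (intro allI impI)
    fix J assume J: "poly_ideal J" "[:N:] \<in> J"
    have HE: "?H - ?E \<in> J" using E assms by (intro lincomb_poly_in_ideal J) auto
    have "F \<in> J \<and> G \<in> J \<longleftrightarrow> F \<in> J \<and> ?H \<in> J"
    proof (intro conj_cong refl)
      assume F: "F \<in> J"
      have yF: "smult ?y (monom 1 (e - d) * F) \<in> J" by (intro poly_ideal_smult poly_ideal_mult J F)
      show "G \<in> J \<longleftrightarrow> ?H \<in> J"
      proof
        assume "G \<in> J"
        hence "(?H - ?E) + (smult ?x G - smult ?y (monom 1 (e - d) * F)) \<in> J"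
          by (intro poly_ideal_add poly_ideal_diff poly_ideal_smult HE yF J)
        thus "?H \<in> J" by simp
      next
        assume "?H \<in> J"
        hence "(?H - (?H - ?E)) + smult ?y (monom 1 (e - d) * F) \<in> J"
          by (intro poly_ideal_add poly_ideal_diff HE yF J)
        hence "smult ?x G \<in> J" by simp
        thus "G \<in> J" by (rule poly_ideal_smult_cancel[OF J FG'(3)])
      qed
    qed
    thus "F \<in> J \<and> ?H \<in> J \<longleftrightarrow> monom 1 1 ^ m - 1 \<in> J \<and> [:a, - 1:] ^ m - 1 \<in> J"
      using FG'(4) J by (auto simp: same_ideal_def)
  qed
  ultimately show ?thesis using FG' by (simp add: euclid_pair_def)
qed

text \<open>Unspecified when the array represents no polynomial; \<open>valid\<close> therefore
  demands the representation explicitly.\<close>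

definition poly_of :: "store \<Rightarrow> nat \<Rightarrow> int poly"
  where "poly_of s A = (THE P. s A = coeff_array P)"

lemma poly_of_eq: "s A = coeff_array P \<Longrightarrow> poly_of s A = P"
  unfolding poly_of_def by (rule the_equality) (auto simp: coeff_array_inject)

definition lincomb :: "nat \<Rightarrow> nat \<Rightarrow> expr \<Rightarrow> expr \<Rightarrow> expr \<Rightarrow> program"
  where "lincomb A B x y k = Seq (set_reg 3 x) (Seq (set_reg 4 y) (Seq (set_reg 5 k) (lincomb_loop A B)))"

definition test_factor :: "expr \<Rightarrow> program"
  where "test_factor e = Seq (Call 0 (Lit 12) binary_gcd [reg 0, e])
    (Cond (Sub (reg 12) (Lit 1)) (Cond (Sub (reg 0) (reg 12)) (set_reg 11 (reg 12)) Skip) Skip)"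

definition test_coeffs_body :: "nat \<Rightarrow> program"
  where "test_coeffs_body A = Seq (test_factor (Get A (reg 6))) (set_reg 6 (Sub (reg 6) (Lit 1)))"

definition test_coeffs :: "nat \<Rightarrow> program"
  where "test_coeffs A = Seq (set_reg 6 (reg 1)) (Loop (Add (reg 6) (Lit 1)) (test_coeffs_body A))"

section \<open>Elementary phases of the program for odd N\<close>

text \<open>The factor 16 leaves room for the sums and doublings of residues and indices within one
  expression, and 64 covers the literals.\<close>

locale factoring_setup =
  fixes w L n m :: nat and N a :: int
  assumes L: "16 * N < 2 ^ L" "64 \<le> (2::int) ^ L" "16 * int m < 2 ^ L"
    and N: "1 < N" "N < 2 ^ n" "odd N" and m: "3 \<le> m" and a: "0 \<le> a" "a < N"
begin

lemma N_pos: "0 < N" using N by simp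

text \<open>Cell 11 may hold a divisor from the start of any phase on; the phases then continue with meaningless
  polynomials, but within the same bounds, so no phase needs an early exit.\<close>

definition valid :: "store \<Rightarrow> bool"
  where "valid s \<longleftrightarrow> s 0 0 = N \<and> s 0 1 = int m \<and> s 0 2 = a \<and>
    (s 0 11 = 0 \<or> 1 < s 0 11 \<and> s 0 11 < N \<and> s 0 11 dvd N) \<and>
    (\<forall>A\<in>{1..8}. s A = coeff_array (poly_of s A) \<and> reduced N m (poly_of s A))"

lemma valid_regs: "valid s \<Longrightarrow> s 0 0 = N" "valid s \<Longrightarrow> s 0 1 = int m" "valid s \<Longrightarrow> s 0 2 = a"
  by (simp_all add: valid_def)

lemma valid_get:
  assumes "valid s" "A \<in> {1..8}"
  shows "s A i = coeff_array (poly_of s A) i" "0 \<le> s A i" "s A i < N" "s A (int j) = coeff (poly_of s A) j"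
  using assms reduced_coeff_array[OF _ N_pos, of m "poly_of s A" i] unfolding valid_def by (metis coeff_array_of_nat)+

lemma valid_reduced: "valid s \<Longrightarrow> A \<in> {1..8} \<Longrightarrow> reduced N m (poly_of s A)"
  by (simp add: valid_def)

lemma poly_of_cong: "s A = t A \<Longrightarrow> poly_of s A = poly_of t A"
  by (simp add: poly_of_def)

lemma valid_cong:
  assumes "valid s" "t 0 0 = s 0 0" "t 0 1 = s 0 1" "t 0 2 = s 0 2"
    "t 0 11 = s 0 11 \<or> 1 < t 0 11 \<and> t 0 11 < N \<and> t 0 11 dvd N"
    "\<And>A. A \<noteq> 0 \<Longrightarrow> t A = s A"
  shows "valid t"
proof -
  have "poly_of t A = poly_of s A" if "A \<noteq> 0" for A
    using assms(6)[OF that] by (rule poly_of_cong)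
  thus ?thesis using assms unfolding valid_def by auto
qed

text \<open>The scalars are stored one after the other, so the second is evaluated after cell 3 has
  changed and the shift after cells 3 and 4 have; the assumptions mention the updated stores
  accordingly.\<close>

lemma lincomb_correct:
  assumes s: "valid s" and AB: "A \<in> {1..8}" "B \<in> {1..8}"
    and ex: "bounded L ex s" "val ex s = x" "0 \<le> x" "x < N"
    and ey: "bounded L ey (store_update s 0 3 x)" "val ey (store_update s 0 3 x) = y" "0 \<le> y" "y < N"
    and ek: "bounded L ek (store_update (store_update s 0 3 x) 0 4 y)"
      "val ek (store_update (store_update s 0 3 x) 0 4 y) = int k" "k \<le> m"
    and nodes: "nodes ex + nodes ey + nodes ek \<le> 17"
  shows "runs w L (lincomb A B ex ey ek) s ((m + 2) * (220 * n + 130))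
    (\<lambda>t. valid t \<and> (\<forall>c. c \<notin> {3..8} \<longrightarrow> t 0 c = s 0 c) \<and>
      poly_of t A = lincomb_poly N m x y k (poly_of s A) (poly_of s B) \<and>
      (\<forall>b. b \<noteq> 0 \<longrightarrow> b \<noteq> A \<longrightarrow> poly_of t b = poly_of s b))"
  unfolding lincomb_def
proof (intro runs_Put_Seq)
  let ?u = "store_update (store_update (store_update s 0 (val (Lit 3) s) (val ex s)) 0
     (val (Lit 4) (store_update s 0 (val (Lit 3) s) (val ex s)))
     (val ey (store_update s 0 (val (Lit 3) s) (val ex s)))) 0
     (val (Lit 5) (store_update (store_update s 0 (val (Lit 3) s) (val ex s)) 0
       (val (Lit 4) (store_update s 0 (val (Lit 3) s) (val ex s)))
       (val ey (store_update s 0 (val (Lit 3) s) (val ex s)))))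
     (val ek (store_update (store_update s 0 (val (Lit 3) s) (val ex s)) 0
       (val (Lit 4) (store_update s 0 (val (Lit 3) s) (val ex s)))
       (val ey (store_update s 0 (val (Lit 3) s) (val ex s)))))"
  have u: "?u = store_update (store_update (store_update s 0 3 x) 0 4 y) 0 5 (int k)"
    using ex ey ek by simp
  have uA: "?u b = s b" if "b \<noteq> 0" for b using that by (simp add: store_update_def)
  have polys: "s A = coeff_array (poly_of s A)" "s B = coeff_array (poly_of s B)"
    "reduced N m (poly_of s A)" "reduced N m (poly_of s B)" using s AB by (auto simp: valid_def)
  have "runs w L (lincomb_loop A B) ?u ((m + 2) * (220 * n + 110))
    (\<lambda>t. t A = coeff_array (lincomb_poly N m x y k (poly_of s A) (poly_of s B)) \<and>
      (\<forall>b i. b \<noteq> A \<longrightarrow> \<not> (b = 0 \<and> i \<in> {6, 7, 8}) \<longrightarrow> t b i = ?u b i))"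
    using AB valid_regs[OF s] polys uA unfolding u
    by (intro lincomb_loop_correct L N N_pos ex(3,4) ey(3,4) ek(3)) (auto simp: store_update_apply)
  thus "runs w L (lincomb_loop A B) ?u ((m + 2) * (220 * n + 130) - (nodes (Lit 3) + nodes ex) -
       (nodes (Lit 4) + nodes ey) - (nodes (Lit 5) + nodes ek))
   (\<lambda>t. valid t \<and> (\<forall>c. c \<notin> {3..8} \<longrightarrow> t 0 c = s 0 c) \<and>
      poly_of t A = lincomb_poly N m x y k (poly_of s A) (poly_of s B) \<and>
      (\<forall>b. b \<noteq> 0 \<longrightarrow> b \<noteq> A \<longrightarrow> poly_of t b = poly_of s b))"
  proof (rule runs_mono)
    \<comment> \<open>The surplus pays for the three assignments, which have at most 17 nodes in
      their right-hand sides and 3 in their cell numbers.\<close>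
    have "(m + 2) * (220 * n + 130) = (m + 2) * (220 * n + 110) + 20 * (m + 2)" by (simp add: algebra_simps)
    thus "(m + 2) * (220 * n + 110) \<le> (m + 2) * (220 * n + 130) - (nodes (Lit 3) + nodes ex) -
       (nodes (Lit 4) + nodes ey) - (nodes (Lit 5) + nodes ek)" using nodes by simp
    fix t assume t: "t A = coeff_array (lincomb_poly N m x y k (poly_of s A) (poly_of s B)) \<and>
      (\<forall>b i. b \<noteq> A \<longrightarrow> \<not> (b = 0 \<and> i \<in> {6, 7, 8}) \<longrightarrow> t b i = ?u b i)"
    have tA: "poly_of t A = lincomb_poly N m x y k (poly_of s A) (poly_of s B)" using t poly_of_eq by blast
    have tb: "t b = s b" if "b \<noteq> 0" "b \<noteq> A" for b
      using t that uA by (auto simp: fun_eq_iff)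
    hence pb: "\<forall>b. b \<noteq> 0 \<longrightarrow> b \<noteq> A \<longrightarrow> poly_of t b = poly_of s b" by (auto intro: poly_of_cong)
    have regs: "\<forall>c. c \<notin> {3..8} \<longrightarrow> t 0 c = s 0 c"
      using t AB unfolding u by (auto simp: store_update_apply)
    have "t b = coeff_array (poly_of t b) \<and> reduced N m (poly_of t b)" if "b \<in> {1..8}" for b
      using that s tA t tb pb reduced_lincomb_poly[OF N_pos] by (cases "b = A") (auto simp: valid_def)
    hence "valid t" using s regs by (auto simp: valid_def)
    thus "valid t \<and> (\<forall>c. c \<notin> {3..8} \<longrightarrow> t 0 c = s 0 c) \<and>
      poly_of t A = lincomb_poly N m x y k (poly_of s A) (poly_of s B) \<and>
      (\<forall>b. b \<noteq> 0 \<longrightarrow> b \<noteq> A \<longrightarrow> poly_of t b = poly_of s b)" using tA regs pb by blast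
  qed
qed (use L ex ey ek nodes in \<open>simp_all add: add.commute trans_le_add2\<close>)

lemma test_factor_correct:
  assumes s: "valid s" and e: "bounded L e s" "val e s = u" "0 \<le> u" "u \<le> N" "nodes e \<le> 10"
  shows "runs w L (test_factor e) s (120 * n + 50)
    (\<lambda>t. valid t \<and> (\<forall>c. c \<notin> {11, 12} \<longrightarrow> t 0 c = s 0 c) \<and> (\<forall>b. b \<noteq> 0 \<longrightarrow> t b = s b) \<and>
      (t 0 11 = 0 \<longrightarrow> s 0 11 = 0 \<and> (coprime u N \<or> N dvd u)))"
proof -
  define g where "g = gcd u N"
  have g: "0 < g" "g \<le> N" "g dvd N" using N by (auto simp: g_def zdvd_imp_le)
  have call: "runs w L binary_gcd (init_store (map (\<lambda>e. val e s) [reg 0, e])) (120 * n + 2) (\<lambda>u. result u = g)"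
    using binary_gcd_correct[OF L(1,2) e(3,4) N(3) N_pos N(2), of w] valid_regs[OF s] e by (simp add: g_def)
  have triv: "coprime u N \<or> N dvd u" if "g = 1 \<or> g = N"
    using that by (metis g_def coprime_iff_gcd_eq_1 gcd_dvd1)
  have post: "valid t \<and> (\<forall>c. c \<notin> {11, 12} \<longrightarrow> t 0 c = s 0 c) \<and> (\<forall>b. b \<noteq> 0 \<longrightarrow> t b = s b) \<and>
      (t 0 11 = 0 \<longrightarrow> s 0 11 = 0 \<and> (coprime u N \<or> N dvd u))"
    if "\<And>c. c \<notin> {11, 12} \<Longrightarrow> t 0 c = s 0 c" "\<And>b. b \<noteq> 0 \<Longrightarrow> t b = s b"
      "t 0 11 = (if 1 < g \<and> g < N then g else s 0 11)" for t
    using that g triv by (intro conjI valid_cong[OF s]) (auto split: if_splits)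
  show ?thesis
    unfolding test_factor_def
  proof (rule runs_Call_Seq[OF call])
    show "runs w L (Cond (Sub (reg 12) (Lit 1)) (Cond (Sub (reg 0) (reg 12)) (set_reg 11 (reg 12)) Skip) Skip)
     (store_update s 0 (val (Lit 12) s) g)
     (120 * n + 50 - (nodes (Lit 12) + sum_list (map nodes [reg 0, e]) + 1 + (120 * n + 2)))
     (\<lambda>t. valid t \<and> (\<forall>c. c \<notin> {11, 12} \<longrightarrow> t 0 c = s 0 c) \<and> (\<forall>b. b \<noteq> 0 \<longrightarrow> t b = s b) \<and>
      (t 0 11 = 0 \<longrightarrow> s 0 11 = 0 \<and> (coprime u N \<or> N dvd u)))"
      by (intro runs_intros post) 
        (use L g e N valid_regs[OF s] in \<open>simp_all add: store_update_apply fun_eq_iff\<close>)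
  qed (use L g e N valid_regs[OF s] in simp_all)
qed

lemma test_coeffs_correct:
  assumes s: "valid s" and A: "A \<in> {1..8}"
  shows "runs w L (test_coeffs A) s ((m + 2) * (120 * n + 70))
    (\<lambda>t. valid t \<and> (\<forall>c. c \<notin> {6, 11, 12} \<longrightarrow> t 0 c = s 0 c) \<and> (\<forall>b. b \<noteq> 0 \<longrightarrow> t b = s b) \<and>
      (t 0 11 = 0 \<longrightarrow> s 0 11 = 0 \<and> (\<forall>i. coprime (coeff (poly_of s A) i) N \<or> N dvd coeff (poly_of s A) i)))"
  unfolding test_coeffs_def
proof (rule runs_Put_Seq)
  define I where "I j t \<longleftrightarrow> valid t \<and> t 0 6 = int j - 1 \<and> j \<le> m + 1 \<and> (\<forall>c. c \<notin> {6, 11, 12} \<longrightarrow> t 0 c = s 0 c) \<and>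
    (\<forall>b. b \<noteq> 0 \<longrightarrow> t b = s b) \<and> (t 0 11 = 0 \<longrightarrow> s 0 11 = 0 \<and>
      (\<forall>i. j \<le> i \<longrightarrow> coprime (coeff (poly_of s A) i) N \<or> N dvd coeff (poly_of s A) i))" for j t
  show "runs w L (Loop (Add (reg 6) (Lit 1)) (test_coeffs_body A)) (store_update s 0 (val (Lit 6) s) (val (reg 1) s))
     ((m + 2) * (120 * n + 70) - (nodes (Lit 6) + nodes (reg 1)))
     (\<lambda>t. valid t \<and> (\<forall>c. c \<notin> {6, 11, 12} \<longrightarrow> t 0 c = s 0 c) \<and> (\<forall>b. b \<noteq> 0 \<longrightarrow> t b = s b) \<and>
      (t 0 11 = 0 \<longrightarrow> s 0 11 = 0 \<and> (\<forall>i. coprime (coeff (poly_of s A) i) N \<or> N dvd coeff (poly_of s A) i)))"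
  proof (rule runs_Loop[where I = I and n = "m + 1" and k = "120 * n + 60"])
    let ?u = "store_update s 0 (val (Lit 6) s) (val (reg 1) s)"
    have "valid ?u" by (rule valid_cong[OF s]) (simp_all add: store_update_apply fun_eq_iff)
    thus "I (m + 1) ?u"
      using valid_reduced[OF s A] valid_regs[OF s] by (auto simp: I_def store_update_apply fun_eq_iff reduced_def)
    fix j t assume I: "I j t"
    hence j: "j \<le> m + 1" and t6: "t 0 6 = int j - 1" and t: "valid t" by (simp_all add: I_def)
    have jL: "int j < 2 ^ L" "\<bar>int j - 1\<bar> < 2 ^ L" "\<bar>int j - 2\<bar> < 2 ^ L" using L j by linarith+
    hence jL': "j < 2 ^ L" by simp
    show "bounded L (Add (reg 6) (Lit 1)) t" using L t6 jL jL' by simp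
    {
      assume "0 < val (Add (reg 6) (Lit 1)) t"
      hence j0: "0 < j" using t6 by simp
      have tA: "poly_of t A = poly_of s A" using I A by (intro poly_of_cong) (auto simp: I_def)
      have val: "val (Get A (reg 6)) t = coeff (poly_of s A) (j - 1)"
        using valid_get(4)[OF t A, of "j - 1"] t6 j0 tA by (simp add: of_nat_diff)
      have rng: "0 \<le> coeff (poly_of s A) (j - 1)" "coeff (poly_of s A) (j - 1) < N"
        using valid_reduced[OF s A] by (auto simp: reduced_def)
      have "runs w L (test_coeffs_body A) t (120 * n + 60) (I (j - 1))"
        unfolding test_coeffs_body_def
      proof (rule runs_Seq[OF test_factor_correct[OF t _ val]])
        show "bounded L (Get A (reg 6)) t" using L t6 jL val rng by simp
        fix u assume u: "valid u \<and> (\<forall>c. c \<notin> {11, 12} \<longrightarrow> u 0 c = t 0 c) \<and> (\<forall>b. b \<noteq> 0 \<longrightarrow> u b = t b) \<and>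
          (u 0 11 = 0 \<longrightarrow> t 0 11 = 0 \<and> (coprime (coeff (poly_of s A) (j - 1)) N \<or> N dvd coeff (poly_of s A) (j - 1)))"
        hence u6: "u 0 6 = int j - 1" using t6 by simp
        let ?v = "store_update u 0 6 (int j - 2)"
        have gv: "valid ?v" by (rule valid_cong[of u]) (use u in \<open>simp_all add: store_update_apply fun_eq_iff\<close>)
        have "I (j - 1) ?v"
          unfolding I_def
        proof (intro conjI impI allI)
          fix i assume z: "?v 0 11 = 0" and i: "j - 1 \<le> i"
          hence "u 0 11 = 0" by (simp add: store_update_apply)
          moreover from this have "t 0 11 = 0" using u by simp
          ultimately show "coprime (coeff (poly_of s A) i) N \<or> N dvd coeff (poly_of s A) i"
            using u I i by (cases "i = j - 1") (auto simp: I_def)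
        qed (use gv u I j j0 in \<open>auto simp: I_def store_update_apply fun_eq_iff\<close>)
        thus "runs w L (set_reg 6 (Sub (reg 6) (Lit 1))) u (120 * n + 60 - (120 * n + 50)) (I (j - 1))"
          by (intro runs_Put) (use L u6 jL in simp_all)
      qed (use rng in simp_all)
      thus "0 < j \<and> runs w L (test_coeffs_body A) t (120 * n + 60) (I (j - 1))" using j0 by blast
    }
    assume "\<not> 0 < val (Add (reg 6) (Lit 1)) t"
    hence "j = 0" using t6 by simp
    thus "valid t \<and> (\<forall>c. c \<notin> {6, 11, 12} \<longrightarrow> t 0 c = s 0 c) \<and> (\<forall>b. b \<noteq> 0 \<longrightarrow> t b = s b) \<and>
      (t 0 11 = 0 \<longrightarrow> s 0 11 = 0 \<and> (\<forall>i. coprime (coeff (poly_of s A) i) N \<or> N dvd coeff (poly_of s A) i))"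
      using I by (simp add: I_def)
  qed (simp add: algebra_simps)
qed (use L nat_less_power[OF L(3)] valid_regs[OF s] in simp_all)

end

section \<open>The Euclidean algorithm on arrays\<close>

text \<open>The factor \<open>c\<close> is a power of the leading coefficient of \<open>F\<close>: reducing by cross-multiplication needs
  no inverses modulo \<open>N\<close>.\<close>

definition represents :: "int \<Rightarrow> int poly \<Rightarrow> nat \<Rightarrow> int \<Rightarrow> int poly \<Rightarrow> int poly \<Rightarrow> bool"
  where "represents N F d c e P \<longleftrightarrow> (\<forall>i\<ge>d. coeff P i = 0) \<and>
    (\<forall>J. poly_ideal J \<longrightarrow> [:N:] \<in> J \<longrightarrow> F \<in> J \<longrightarrow> P - smult c e \<in> J)"

lemma represents_cong:
  assumes "represents N F d c e P" "[:N:] dvd e - e'"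
  shows "represents N F d c e' P"
  unfolding represents_def
proof (intro conjI allI impI)
  fix J assume J: "poly_ideal J" "[:N:] \<in> J" "F \<in> J"
  have "P - smult c e \<in> J" "e - e' \<in> J"
    using assms J poly_ideal_const_dvd_poly[OF J(1,2)] by (auto simp: represents_def)
  hence "(P - smult c e) + smult c (e - e') \<in> J" by (intro poly_ideal_add poly_ideal_smult J)
  thus "P - smult c e' \<in> J" by (simp add: smult_diff_right)
qed (use assms in \<open>auto simp: represents_def\<close>)

text \<open>Both arguments carry the same factor \<open>c\<close>. The scalar of \<open>Q\<close> is
  \<open>x * y\<close>, so that the result carries one common factor again, namely
  \<open>x * c\<close>.\<close>

lemma represents_lincomb_poly:
  assumes P: "represents N F d c e P" and Q: "represents N F d c f Q" and d: "d \<le> m + 1"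
  shows "represents N F d (x * c) (e - smult y f) (lincomb_poly N m x (x * y) 0 P Q)"
  unfolding represents_def
proof (intro conjI allI impI)
  fix i assume "d \<le> i"
  thus "coeff (lincomb_poly N m x (x * y) 0 P Q) i = 0" using P Q by (simp add: coeff_lincomb_poly represents_def)
next
  fix J assume J: "poly_ideal J" "[:N:] \<in> J" "F \<in> J"
  let ?H = "lincomb_poly N m x (x * y) 0 P Q"
  have p: "P - smult c e \<in> J" and q: "Q - smult c f \<in> J" using P Q J by (auto simp: represents_def)
  have h: "?H - (smult x P - smult (x * y) (monom 1 0 * Q)) \<in> J"
    using P Q d by (intro lincomb_poly_in_ideal J) (auto simp: represents_def coeff_monom_mult)
  have "(?H - (smult x P - smult (x * y) (monom 1 0 * Q))) +
      smult x ((P - smult c e) - smult y (Q - smult c f)) \<in> J"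
    by (rule poly_ideal_add[OF J(1) h poly_ideal_smult[OF J(1) poly_ideal_diff[OF J(1) p poly_ideal_smult[OF J(1) q]]]])
  also have "(?H - (smult x P - smult (x * y) (monom 1 0 * Q))) +
      smult x ((P - smult c e) - smult y (Q - smult c f)) = ?H - smult (x * c) (e - smult y f)"
    by (simp add: smult_diff_right monom_0 one_pCons[symmetric] mult.commute mult.left_commute)
  finally show "?H - smult (x * c) (e - smult y f) \<in> J" .
qed

text \<open>The degree bound rises by one; \<open>d \<le> m\<close> keeps the new top coefficient
  inside the array.\<close>

lemma represents_shift:
  assumes P: "represents N F d c e P" and d: "d \<le> m"
  shows "represents N F (d + 1) c ([:x, -y:] * e) (lincomb_poly N m x y 1 P P)"
  unfolding represents_def
proof (intro conjI allI impI)
  have Pd: "\<And>i. d \<le> i \<Longrightarrow> coeff P i = 0" using P by (simp add: represents_def)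
  fix i assume "d + 1 \<le> i"
  thus "coeff (lincomb_poly N m x y 1 P P) i = 0" using Pd[of i] Pd[of "i - 1"] by (simp add: coeff_lincomb_poly)
next
  have Pd: "\<And>i. d \<le> i \<Longrightarrow> coeff P i = 0" using P by (simp add: represents_def)
  fix J assume J: "poly_ideal J" "[:N:] \<in> J" "F \<in> J"
  have "lincomb_poly N m x y 1 P P - (smult x P - smult y (monom 1 1 * P)) \<in> J"
    using d Pd by (intro lincomb_poly_in_ideal J) (auto simp: coeff_monom_mult)
  also have "smult x P - smult y (monom 1 1 * P) = [:x, -y:] * P" by (simp add: monom_altdef)
  finally have 1: "lincomb_poly N m x y 1 P P - [:x, -y:] * P \<in> J" .
  have 2: "[:x, -y:] * (P - smult c e) \<in> J" using P J by (intro poly_ideal_mult J) (simp add: represents_def)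
  have "p1 - v * p + v * (p - smult c e) = p1 - smult c (v * e)" for p1 p v :: "int poly"
    by (simp add: algebra_simps)
  with poly_ideal_add[OF J(1) 1 2] show "lincomb_poly N m x y 1 P P - smult c ([:x, -y:] * e) \<in> J" by (simp only:)
qed

text \<open>Multiplication by \<open>x - y X\<close>, followed by one step of pseudo-division by \<open>F\<close>.\<close>

definition mult_reduce :: "int \<Rightarrow> nat \<Rightarrow> int poly \<Rightarrow> nat \<Rightarrow> int \<Rightarrow> int \<Rightarrow> int poly \<Rightarrow> int poly"
  where "mult_reduce N m F d x y P =
    (let P1 = lincomb_poly N m x y 1 P P in lincomb_poly N m (coeff F d) (coeff P1 d) 0 P1 F)"

text \<open>Eliminating the single coefficient at \<open>d\<close> restores the degree bound, at the
  price of one more leading coefficient in the factor. The parameter \<open>z\<close> admits a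
  congruent multiplier: X is obtained from x = 0 and y = N - 1.\<close>

lemma represents_mult_reduce:
  assumes P: "represents N F d c e P" and F: "\<And>i. i > d \<Longrightarrow> coeff F i = 0" and d: "d \<le> m"
    and z: "[:N:] dvd [:x, -y:] - z"
  shows "represents N F d (coeff F d * c) (z * e) (mult_reduce N m F d x y P)"
proof -
  define P1 where "P1 = lincomb_poly N m x y 1 P P"
  let ?l = "coeff F d" and ?r = "coeff P1 d"
  let ?P2 = "lincomb_poly N m ?l ?r 0 P1 F"
  have P1: "represents N F (d + 1) c ([:x, -y:] * e) P1"
    unfolding P1_def by (rule represents_shift[OF P d])
  hence P1': "\<And>i. d < i \<Longrightarrow> coeff P1 i = 0" by (simp add: represents_def)
  have "represents N F d (?l * c) ([:x, -y:] * e) ?P2"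
    unfolding represents_def
  proof (intro conjI allI impI)
    fix i assume "d \<le> i"
    thus "coeff ?P2 i = 0" using P1' F by (cases "d = i") (auto simp: coeff_lincomb_poly)
  next
    fix J assume J: "poly_ideal J" "[:N:] \<in> J" "F \<in> J"
    have 2: "?P2 - (smult ?l P1 - smult ?r F) \<in> J"
      using lincomb_poly_in_ideal[OF J(1,2), of m ?l P1 ?r 0 F] d P1' F by (simp add: monom_0 one_pCons[symmetric])
    have 1: "P1 - smult c ([:x, -y:] * e) \<in> J" using P1 J by (simp add: represents_def)
    have "(?P2 - (smult ?l P1 - smult ?r F)) + (smult ?l (P1 - smult c ([:x, -y:] * e)) - smult ?r F) \<in> J"
      by (rule poly_ideal_add[OF J(1) 2 poly_ideal_diff[OF J(1) poly_ideal_smult[OF J(1) 1] poly_ideal_smult[OF J(1,3)]]])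
    moreover have "(p2 - (smult l p1 - f)) + (smult l (p1 - smult c v) - f) = p2 - smult (l * c) v"
      for p2 p1 f v :: "int poly" and l by (simp add: algebra_simps smult_diff_right)
    ultimately show "?P2 - smult (?l * c) ([:x, -y:] * e) \<in> J" by (simp only:)
  qed
  moreover have "[:N:] dvd [:x, -y:] * e - z * e" using z by (metis dvd_mult2 left_diff_distrib)
  ultimately show ?thesis unfolding mult_reduce_def Let_def P1_def[symmetric] by (rule represents_cong)
qed

text \<open>The scalar \<open>N - 1\<close> turns the subtraction in \<^const>\<open>lincomb\<close> into an addition.\<close>

definition copy_poly :: "nat \<Rightarrow> nat \<Rightarrow> program"
  where "copy_poly A B = lincomb A B (Lit 0) (Sub (reg 0) (Lit 1)) (Lit 0)"

definition swap_polys :: program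
  where "swap_polys = Seq (copy_poly 3 1) (Seq (copy_poly 1 2) (Seq (copy_poly 2 3)
    (Seq (set_reg 13 (reg 9)) (Seq (set_reg 9 (reg 10)) (set_reg 10 (reg 13))))))"

definition eliminate :: program
  where "eliminate = lincomb 2 1 (Get 1 (reg 9)) (Get 2 (reg 10)) (Sub (reg 10) (reg 9))"

text \<open>Each round lowers the sum of the two degree bounds by one. A nonzero top coefficient of
  the second polynomial is tested before that polynomial may become the divisor; this is where a
  leading coefficient with a factor in common with \<open>N\<close> is caught.\<close>

definition euclid_body :: program
  where "euclid_body =
    Seq (Cond (Get 2 (reg 10))
          (Seq (test_factor (Get 2 (reg 10))) (Seq (Cond (Sub (reg 9) (reg 10)) swap_polys Skip) eliminate))
          Skip)
        (set_reg 10 (Sub (reg 10) (Lit 1)))"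

definition euclid :: program
  where "euclid = Loop (Add (reg 10) (Lit 1)) euclid_body"

section \<open>Correctness and cost of the Euclidean phase\<close>

context factoring_setup
begin

definition lincomb_cost :: nat
  where "lincomb_cost = (m + 2) * (220 * n + 130)"

lemma lincomb_cost_ge: "120 * n + 50 \<le> lincomb_cost" "(m + 2) * (120 * n + 70) \<le> lincomb_cost" "260 \<le> lincomb_cost"
proof -
  have *: "2 * (220 * n + 130) \<le> lincomb_cost" unfolding lincomb_cost_def by (intro mult_le_mono1) simp
  show "120 * n + 50 \<le> lincomb_cost" by (rule order_trans[OF _ *]) simp
  show "260 \<le> lincomb_cost" by (rule order_trans[OF _ *]) simp
  show "(m + 2) * (120 * n + 70) \<le> lincomb_cost" unfolding lincomb_cost_def by (intro mult_le_mono2) simp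
qed

lemmas lincomb_runs = lincomb_correct[folded lincomb_cost_def]

lemma copy_poly_correct:
  assumes s: "valid s" and AB: "A \<in> {1..8}" "B \<in> {1..8}"
  shows "runs w L (copy_poly A B) s lincomb_cost
    (\<lambda>t. valid t \<and> (\<forall>c. c \<notin> {3..8} \<longrightarrow> t 0 c = s 0 c) \<and> poly_of t A = poly_of s B \<and>
      (\<forall>b. b \<noteq> 0 \<longrightarrow> b \<noteq> A \<longrightarrow> poly_of t b = poly_of s b))"
  unfolding copy_poly_def
  by (rule runs_mono[OF lincomb_runs[OF s AB, where x = 0 and y = "N - 1" and k = 0]])
    (use L N valid_regs[OF s] lincomb_poly_copy[OF valid_reduced[OF s AB(2)]] in \<open>simp_all add: store_update_apply\<close>)

lemma swap_polys_correct:
  assumes s: "valid s" and r: "\<bar>s 0 9\<bar> < 2 ^ L" "\<bar>s 0 10\<bar> < 2 ^ L"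
  shows "runs w L swap_polys s (3 * lincomb_cost + 20)
    (\<lambda>t. valid t \<and> t 0 9 = s 0 10 \<and> t 0 10 = s 0 9 \<and> t 0 11 = s 0 11 \<and>
      poly_of t 1 = poly_of s 2 \<and> poly_of t 2 = poly_of s 1 \<and> (\<forall>b. b \<notin> {0, 1, 2, 3} \<longrightarrow> poly_of t b = poly_of s b))"
    (is "runs w L swap_polys s _ ?Q")
  unfolding swap_polys_def
proof (rule runs_Seq[OF copy_poly_correct[OF s]], goal_cases)
  case (3 t1)
  show ?case
  proof (rule runs_Seq[OF copy_poly_correct], goal_cases)
    case (4 t2)
    show ?case
    proof (rule runs_Seq[OF copy_poly_correct], goal_cases)
      case (4 t3)
      have t3: "valid t3" "t3 0 9 = s 0 9" "t3 0 10 = s 0 10" "t3 0 11 = s 0 11"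
        "poly_of t3 1 = poly_of s 2" "poly_of t3 2 = poly_of s 1"
        "\<And>b. b \<notin> {0, 1, 2, 3} \<Longrightarrow> poly_of t3 b = poly_of s b"
        using 3 \<open>valid t2 \<and> _\<close> 4 by simp_all
      have fin: "?Q u" if u: "u 0 9 = s 0 10" "u 0 10 = s 0 9" "\<And>c. c \<notin> {9, 10, 13} \<Longrightarrow> u 0 c = t3 0 c"
        "\<And>b. b \<noteq> 0 \<Longrightarrow> u b = t3 b" for u
      proof -
        have "valid u" by (rule valid_cong[OF t3(1)]) (use u in simp_all)
        moreover have "poly_of u b = poly_of t3 b" if "b \<noteq> 0" for b using u(4)[OF that] by (rule poly_of_cong)
        ultimately show ?thesis using t3 u by simp
      qed
      show ?case
        by (intro runs_intros fin) (use t3 r L in \<open>simp_all add: store_update_apply fun_eq_iff\<close>)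
    qed (use 4 in simp_all)
  qed (use 3 in simp_all)
qed simp_all

text \<open>Arrays 4, 5 and 6 hold the zeroth powers with which the search will begin; they merely
  have to survive this phase.\<close>

definition euclid_state :: "nat \<Rightarrow> int \<Rightarrow> store \<Rightarrow> bool"
  where "euclid_state d e t \<longleftrightarrow> valid t \<and> (\<forall>A\<in>{4, 5, 6, 8}. poly_of t A = 1) \<and>
    t 0 9 = int d \<and> t 0 10 = e \<and> d \<le> m \<and> - 1 \<le> e \<and> e \<le> int m \<and>
    (t 0 11 = 0 \<longrightarrow> euclid_pair N m a d e (poly_of t 1) (poly_of t 2))"

lemma int_le_m_bounded: "- 2 \<le> i \<Longrightarrow> i \<le> int m \<Longrightarrow> \<bar>i\<bar> < 2 ^ L"
  using L by linarith

lemma eliminate_correct: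
  assumes t: "euclid_state d (int e) t" and de: "d \<le> e"
  shows "runs w L (Seq eliminate (set_reg 10 (Sub (reg 10) (Lit 1)))) t (lincomb_cost + 10) (euclid_state d (int e - 1))"
proof -
  have t': "valid t" "t 0 9 = int d" "t 0 10 = int e" "d \<le> m" "e \<le> m" using t by (auto simp: euclid_state_def)
  have b: "\<bar>int d\<bar> < 2 ^ L" "\<bar>int e\<bar> < 2 ^ L" "\<bar>int e - int d\<bar> < 2 ^ L" "\<bar>int e - 1\<bar> < 2 ^ L"
    using t' de by (intro int_le_m_bounded; simp)+
  have 1: "t 1 (int d) = coeff (poly_of t 1) d" "0 \<le> coeff (poly_of t 1) d" "coeff (poly_of t 1) d < N"
    using valid_get(2,3)[OF t'(1), of 1 "int d"] valid_get(4)[OF t'(1), of 1 d] by auto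
  have 2: "t 2 (int e) = coeff (poly_of t 2) e" "0 \<le> coeff (poly_of t 2) e" "coeff (poly_of t 2) e < N"
    using valid_get(2,3)[OF t'(1), of 2 "int e"] valid_get(4)[OF t'(1), of 2 e] by auto
  show ?thesis
    unfolding eliminate_def
  proof (rule runs_Seq[OF lincomb_runs[OF t'(1), where x = "coeff (poly_of t 1) d" and y = "coeff (poly_of t 2) e" and k = "e - d"]], goal_cases)
    case (15 u)
    let ?v = "store_update u 0 10 (int e - 1)"
    have u: "u 0 10 = int e" using 15 t' by simp
    have "valid ?v" by (rule valid_cong[of u]) (use 15 in \<open>simp_all add: store_update_apply fun_eq_iff\<close>)
    moreover have "poly_of ?v b = poly_of u b" if "b \<noteq> 0" for b
      by (rule poly_of_cong) (use that in \<open>simp add: store_update_def\<close>)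
    ultimately have "euclid_state d (int e - 1) ?v"
      using t t' 15 euclid_pair_eliminate[of N m a d e "poly_of t 1" "poly_of t 2"] de
      by (auto simp: euclid_state_def store_update_apply)
    thus ?case by (intro runs_Put) (use L u b in simp_all)
  qed (use L t' b 1 2 de N in \<open>simp_all add: store_update_apply\<close>)
qed

lemma euclid_body_correct:
  assumes t: "euclid_state d (int e) t"
  shows "runs w L euclid_body t (5 * lincomb_cost + 100)
    (\<lambda>u. \<exists>d' e'. euclid_state d' e' u \<and> int d' + e' = int d + int e - 1)"
    (is "runs _ _ _ _ _ ?Q")
proof -
  have t': "valid t" "t 0 9 = int d" "t 0 10 = int e" "d \<le> m" "e \<le> m" using t by (auto simp: euclid_state_def)
  have b: "\<bar>int d\<bar> < 2 ^ L" "\<bar>int e\<bar> < 2 ^ L" "\<bar>int d - int e\<bar> < 2 ^ L" "\<bar>int e - 1\<bar> < 2 ^ L"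
    using t' L by linarith+
  define y where "y = coeff (poly_of t 2) e"
  have y: "t 2 (int e) = y" "0 \<le> y" "y < N"
    using valid_get(2,3)[OF t'(1), of 2 "int e"] valid_get(4)[OF t'(1), of 2 e] by (auto simp: y_def)
  show ?thesis
    unfolding euclid_body_def
  proof (rule runs_Cond_Seq, goal_cases)
    case 3
    hence y0: "0 < y" using t' y by simp
    show ?case
    proof (rule runs_Seq_assoc, rule runs_Seq[OF test_factor_correct[OF t'(1), where u = y]], goal_cases)
      case (6 u)
      have pu: "poly_of u A = poly_of t A" if "A \<noteq> 0" for A using 6 that by (intro poly_of_cong) simp
      have u: "euclid_state d (int e) u" using t 6 pu by (auto simp: euclid_state_def)
      \<comment> \<open>Strictly between 0 and \<open>N\<close>, \<open>y\<close> is no multiple of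
        \<open>N\<close>; if no divisor was recorded, only coprimality remains.\<close>
      have cop: "coprime y N" if "u 0 11 = 0"
        using that 6 y y0 by (auto dest: zdvd_imp_le)
      have ur: "u 0 9 = int d" "u 0 10 = int e" "valid u" using u by (auto simp: euclid_state_def)
      show ?case
      proof (rule runs_Seq_assoc, rule runs_Cond_Seq, goal_cases)
        case 3
        hence de: "e \<le> d" using ur by simp
        show ?case
        proof (rule runs_Seq[OF swap_polys_correct[OF ur(3)]], goal_cases)
          case (3 v)
          have "euclid_state e (int d) v"
            using 3 u ur pu t' cop euclid_pair_swap[of N m a d e "poly_of u 1" "poly_of u 2"]
            by (auto simp: euclid_state_def y_def)
          from eliminate_correct[OF this de] show ?case
            by (rule runs_mono) (use lincomb_cost_ge in \<open>auto intro!: exI[of _ e]\<close>)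
        qed (use ur b lincomb_cost_ge in simp_all)
      next
        case 4
        hence de: "d \<le> e" using ur by simp
        show ?case
          by (rule runs_Skip_Seq, rule runs_mono[OF eliminate_correct[OF u de]])
            (use lincomb_cost_ge in \<open>auto intro!: exI[of _ d]\<close>)
      qed (use ur b L lincomb_cost_ge in simp_all)
    qed (use t' b y L lincomb_cost_ge in simp_all)
  next
    case 4
    hence y0: "y = 0" using t' y by simp
    let ?v = "store_update t 0 10 (int e - 1)"
    have "valid ?v" by (rule valid_cong[OF t'(1)]) (simp_all add: store_update_apply fun_eq_iff)
    moreover have "poly_of ?v b = poly_of t b" if "b \<noteq> 0" for b
      by (rule poly_of_cong) (use that in \<open>simp add: store_update_def\<close>)
    moreover have "euclid_pair N m a d (int e - 1) F G" if "euclid_pair N m a d (int e) F G" "coeff G e = 0" for F G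
      using that unfolding euclid_pair_def by (metis int_ops(1) linorder_cases of_nat_less_iff zle_diff1_eq not_le order_less_le zless_imp_add1_zle diff_add_cancel)
    ultimately have "euclid_state d (int e - 1) ?v"
      using t y0 by (auto simp: euclid_state_def store_update_apply y_def)
    hence "?Q ?v" by (intro exI[of _ d] exI[of _ "int e - 1"]) simp
    thus ?case
      by (intro runs_Skip_Seq runs_Put) (use L t' b in simp_all)
  qed (use t' b y L in simp_all)
qed

lemma euclid_correct:
  assumes s: "euclid_state m (int m) s"
  shows "runs w L euclid s ((2 * m + 2) * (5 * lincomb_cost + 110)) (\<lambda>t. \<exists>d. euclid_state d (-1) t)"
  unfolding euclid_def
\<comment> \<open>The measure d + e + 1 is nonnegative because e is at least -1, and starts at
  \<open>2 * m + 1\<close>.\<close>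
proof (rule runs_Loop[where I = "\<lambda>j t. \<exists>d e. euclid_state d e t \<and> int j = int d + e + 1" and n = "2 * m + 1" and k = "5 * lincomb_cost + 100"], goal_cases)
  case 1
  show ?case using s by (intro exI[of _ m] exI[of _ "int m"]) simp
next
  case (2 j t)
  then obtain d e where e: "euclid_state d e t" by blast
  have "\<bar>e\<bar> < 2 ^ L" "\<bar>e + 1\<bar> < 2 ^ L" using e L by (auto simp: euclid_state_def)
  thus ?case using e L by (auto simp: euclid_state_def)
next
  case (3 j t)
  then obtain d e where e: "euclid_state d e t" "int j = int d + e + 1" by blast
  hence "0 \<le> e" using 3(2) by (simp add: euclid_state_def)
  then obtain e' where e': "e = int e'" by (metis zero_le_imp_eq_int)
  have j: "0 < j" using e(2) e' by auto
  have "runs w L euclid_body t (5 * lincomb_cost + 100) (\<lambda>u. \<exists>d e. euclid_state d e u \<and> int (j - 1) = int d + e + 1)"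
  proof (rule runs_mono[OF euclid_body_correct order_refl])
    show "euclid_state d (int e') t" using e(1) e' by simp
    fix u assume "\<exists>d' e''. euclid_state d' e'' u \<and> int d' + e'' = int d + int e' - 1"
    then obtain d' e'' where "euclid_state d' e'' u" "int d' + e'' = int d + int e' - 1" by blast
    moreover from this have "int (j - 1) = int d' + e'' + 1" using e(2) e' j by (simp add: of_nat_diff)
    ultimately show "\<exists>d e. euclid_state d e u \<and> int (j - 1) = int d + e + 1" by blast
  qed
  thus ?case using e(2) e' by auto
next
  case (4 j t)
  then obtain d e where e: "euclid_state d e t" by blast
  hence "e = -1" using 4(2) by (simp add: euclid_state_def)
  thus ?case using e by blast
next
  case 5
  show ?case by (simp add: algebra_simps)
qed

end

section \<open>Search for a separating coefficient\<close>

lemma coeff_array_0: "coeff_array 0 = (\<lambda>j. 0)"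
  by (auto simp: coeff_array_def)

lemma coeff_array_monom: "coeff_array (monom c k) = (\<lambda>j. if j = int k then c else 0)"
  by (auto simp: coeff_array_def fun_eq_iff)

lemma coeff_array_1: "coeff_array 1 = (\<lambda>j. if j = 0 then 1 else 0)"
  using coeff_array_monom[of 1 0] by (simp add: monom_0 one_pCons)

definition prepare :: program
  where "prepare = Seq (Put 1 (reg 1) (Lit 1)) (Seq (Put 2 (Lit 0) (Lit 1)) (Seq (Put 4 (Lit 0) (Lit 1))
    (Seq (Put 5 (Lit 0) (Lit 1)) (Seq (Put 6 (Lit 0) (Lit 1)) (Seq (Put 8 (Lit 0) (Lit 1))
    (Seq (set_reg 9 (reg 1)) (Seq (set_reg 10 (reg 1)) (set_reg 13 (reg 1)))))))))"

definition power_body :: program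
  where "power_body = Seq (lincomb 2 2 (reg 2) (Lit 1) (Lit 1)) (set_reg 13 (Sub (reg 13) (Lit 1)))"

definition setup_polys :: program
  where "setup_polys = Seq prepare (Seq (Loop (reg 13) power_body)
    (Seq (lincomb 2 8 (Lit 1) (Lit 1) (Lit 0)) (lincomb 1 8 (Lit 1) (Lit 1) (Lit 0))))"

definition mult_reduce_step :: "nat \<Rightarrow> expr \<Rightarrow> expr \<Rightarrow> program"
  where "mult_reduce_step A x y = Seq (lincomb A A x y (Lit 1)) (lincomb A 1 (Get 1 (reg 9)) (Get A (reg 9)) (Lit 0))"

text \<open>Arrays 4 and 5 are multiplied by a - X and by X, the latter written as 0 - (N - 1) X.
  Each reduction brings in a leading coefficient, and array 6 is scaled by it too, so that the three
  share their factor and array 7 becomes that factor times the defect.\<close>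

definition search_body :: program
  where "search_body =
    Seq (mult_reduce_step 4 (reg 2) (Lit 1))
   (Seq (mult_reduce_step 5 (Lit 0) (Sub (reg 0) (Lit 1)))
   (Seq (lincomb 6 6 (Get 1 (reg 9)) (Lit 0) (Lit 0))
   (Seq (copy_poly 7 4)
   (Seq (lincomb 7 5 (Lit 1) (Sub (reg 0) (Lit 1)) (Lit 0))
   (Seq (lincomb 7 6 (Lit 1) (reg 2) (Lit 0))
   (Seq (test_coeffs 7) (set_reg 13 (Sub (reg 13) (Lit 1)))))))))"

definition factor_odd :: program
  where "factor_odd = Seq setup_polys (Seq euclid (Seq (set_reg 13 (reg 1))
    (Seq (Loop (reg 13) search_body) (set_reg 0 (reg 11)))))"

definition factor_program :: program
  where "factor_program = Cond (parity (reg 0)) factor_odd (set_reg 0 (Lit 2))"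

text \<open>Array 7 is overwritten in every round; the invariant remembers only that some remainder
  passed the gcd test.\<close>

definition tested :: "int \<Rightarrow> int poly \<Rightarrow> nat \<Rightarrow> int \<Rightarrow> nat \<Rightarrow> bool"
  where "tested N F d a r \<longleftrightarrow> (\<exists>H. represents N F d (coeff F d ^ r) (power_sum_defect a r) H \<and>
    (\<forall>i. coprime (coeff H i) N \<or> N dvd coeff H i))"

section \<open>Correctness and cost of the preparation and the search\<close>

context factoring_setup
begin

lemma poly_of_store_update_reg: "b \<noteq> 0 \<Longrightarrow> poly_of (store_update s 0 c v) b = poly_of s b"
  by (rule poly_of_cong) (simp add: store_update_def)

lemma valid_store_update_reg: "valid s \<Longrightarrow> c \<notin> {0, 1, 2, 11} \<Longrightarrow> valid (store_update s 0 c v)"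
  by (rule valid_cong[of s]) (auto simp: store_update_apply fun_eq_iff)

lemma prepare_correct:
  "runs w L prepare (init_store [N, int m, a]) 40
    (\<lambda>t. valid t \<and> t 0 9 = int m \<and> t 0 10 = int m \<and> t 0 11 = 0 \<and> t 0 13 = int m \<and>
      poly_of t 1 = monom 1 m \<and> (\<forall>A\<in>{2, 4, 5, 6, 8}. poly_of t A = 1))"
    (is "runs _ _ _ ?s _ ?Q")
proof -
  have fin: "?Q t" if t: "t 0 0 = N" "t 0 1 = int m" "t 0 2 = a" "t 0 9 = int m" "t 0 10 = int m" "t 0 11 = 0" "t 0 13 = int m"
    "t 1 = coeff_array (monom 1 m)" "t 2 = coeff_array 1" "t 3 = coeff_array 0" "t 4 = coeff_array 1" "t 5 = coeff_array 1" "t 6 = coeff_array 1" "t 7 = coeff_array 0" "t 8 = coeff_array 1" for t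
  proof -
    have p: "poly_of t 1 = monom 1 m" "poly_of t 2 = 1" "poly_of t 3 = 0" "poly_of t 4 = 1" "poly_of t 5 = 1"
      "poly_of t 6 = 1" "poly_of t 7 = 0" "poly_of t 8 = 1"
      using t by (auto intro: poly_of_eq)
    have "reduced N m (monom 1 m)" "reduced N m 1" "reduced N m 0" using N by (auto simp: reduced_def)
    moreover have "A \<in> {1, 2, 3, 4, 5, 6, 7, 8}" if "A \<in> {1..8}" for A :: nat using that by auto
    ultimately have "t A = coeff_array (poly_of t A) \<and> reduced N m (poly_of t A)" if "A \<in> {1..8}" for A
      using that t p by fastforce
    thus ?thesis using t p by (simp add: valid_def)
  qed
  have [simp]: "?s 0 0 = N" "?s 0 1 = int m" "?s 0 2 = a" "?s 0 11 = 0" "b \<noteq> 0 \<Longrightarrow> ?s b i = 0" for b i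
    by (simp_all add: init_store_apply nat_numeral)
  show ?thesis
    unfolding prepare_def
    by ((rule runs_Put_Seq, (use L nat_less_power[OF L(3)] in \<open>simp_all add: store_update_apply\<close>)[3],
          simp only: val.simps)+, intro runs_Put fin)
      (use L nat_less_power[OF L(3)] in \<open>simp_all add: store_update_apply coeff_array_0 coeff_array_1 coeff_array_monom fun_eq_iff\<close>)
qed

text \<open>With \<open>F = 0\<close> and factor 1, \<open>represents\<close> expresses congruence
  modulo \<open>N\<close> with a degree bound. The power of a - X reaches degree \<open>m\<close> at
  most, so no reduction is required.\<close>

lemma power_loop_correct:
  assumes s: "valid s" "s 0 9 = int m" "s 0 10 = int m" "s 0 11 = 0" "s 0 13 = int m"
    "poly_of s 1 = monom 1 m" "\<forall>A\<in>{2, 4, 5, 6, 8}. poly_of s A = 1"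
  shows "runs w L (Loop (reg 13) power_body) s ((m + 1) * (lincomb_cost + 15))
    (\<lambda>t. valid t \<and> t 0 9 = int m \<and> t 0 10 = int m \<and> t 0 11 = 0 \<and>
      poly_of t 1 = monom 1 m \<and> (\<forall>A\<in>{4, 5, 6, 8}. poly_of t A = 1) \<and>
      represents N 0 (m + 1) 1 ([:a, -1:] ^ m) (poly_of t 2))"
proof (rule runs_Loop[where I = "\<lambda>j t. valid t \<and> t 0 9 = int m \<and> t 0 10 = int m \<and> t 0 11 = 0 \<and> t 0 13 = int j \<and> j \<le> m \<and>
      poly_of t 1 = monom 1 m \<and> (\<forall>A\<in>{4, 5, 6, 8}. poly_of t A = 1) \<and>
      represents N 0 (m - j + 1) 1 ([:a, -1:] ^ (m - j)) (poly_of t 2)" and n = m and k = "lincomb_cost + 10"], goal_cases)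
  case 1
  have "represents N 0 1 1 1 1" by (auto simp: represents_def poly_ideal_zero simp flip: one_pCons)
  thus ?case using s by simp
next
  case (2 j t)
  hence "\<bar>int j\<bar> < 2 ^ L" using L by linarith
  thus ?case using 2 L by simp
next
  case (3 j t)
  hence j: "0 < j" "j \<le> m" by auto
  have "\<bar>int j\<bar> < 2 ^ L" "\<bar>int j - 1\<bar> < 2 ^ L" using j L by linarith+
  note b = this
  have t: "valid t" using 3 by simp
  have "runs w L power_body t (lincomb_cost + 10) (\<lambda>t. valid t \<and> t 0 9 = int m \<and> t 0 10 = int m \<and> t 0 11 = 0 \<and> t 0 13 = int (j - 1) \<and> j - 1 \<le> m \<and>
      poly_of t 1 = monom 1 m \<and> (\<forall>A\<in>{4, 5, 6, 8}. poly_of t A = 1) \<and>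
      represents N 0 (m - (j - 1) + 1) 1 ([:a, -1:] ^ (m - (j - 1))) (poly_of t 2))"
    unfolding power_body_def
  proof (rule runs_Seq[OF lincomb_runs[OF t, where x = a and y = 1 and k = 1]], goal_cases)
    case (15 u)
    have "represents N 0 (m - j + 1 + 1) 1 ([:a, -1:] * [:a, -1:] ^ (m - j)) (poly_of u 2)"
      using 15 3 j represents_shift[of N 0 "m - j + 1" 1 "[:a, -1:] ^ (m - j)" "poly_of t 2" m a 1] by simp
    moreover have "m - j + 1 = m - (j - 1)" using j by simp
    ultimately have r: "represents N 0 (m - (j - 1) + 1) 1 ([:a, -1:] ^ (m - (j - 1))) (poly_of u 2)"
      by (metis Suc_eq_plus1 power_Suc)
    show ?case
      using 15 3 j b L r
      by (intro runs_Put) (auto simp: store_update_apply poly_of_store_update_reg valid_store_update_reg of_nat_diff)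
  qed (use L N a m t valid_regs[OF t] in \<open>simp_all add: store_update_apply\<close>)
  thus ?case using j by blast
next
  case (4 j t)
  thus ?case by simp
next
  case 5
  show ?case by (simp add: algebra_simps)
qed

lemma setup_polys_correct:
  "runs w L setup_polys (init_store [N, int m, a]) ((m + 4) * (lincomb_cost + 15)) (euclid_state m (int m))"
  unfolding setup_polys_def
proof (rule runs_Seq[OF prepare_correct], goal_cases)
  case (1 t)
  show ?case
  proof (rule runs_Seq[OF power_loop_correct], goal_cases)
    case (8 u)
    hence u: "valid u" by simp
    show ?case
    proof (rule runs_Seq[OF lincomb_runs[OF u, where x = 1 and y = 1 and k = 0]], goal_cases)
      case (15 v)
      hence v: "valid v" by simp
      show ?case
      proof (rule runs_mono[OF lincomb_runs[OF v, where x = 1 and y = 1 and k = 0]], goal_cases)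
        case (16 t')
        let ?F = "poly_of t' 1" and ?G = "poly_of t' 2"
        have one: "represents N 0 (m + 1) 1 1 1" and X: "represents N 0 (m + 1) 1 (monom 1 1 ^ m) (monom 1 m)"
          by (auto simp: represents_def poly_ideal_zero monom_power simp flip: one_pCons)
        have F: "represents N 0 (m + 1) 1 (monom 1 1 ^ m - 1) ?F"
          using represents_lincomb_poly[OF X one, of m 1 1] 16 15 8 by (simp flip: one_pCons)
        have G: "represents N 0 (m + 1) 1 ([:a, -1:] ^ m - 1) ?G"
          using represents_lincomb_poly[OF _ one, where P = "poly_of u 2" and e = "[:a, -1:] ^ m" and x = 1 and y = 1 and m = m] 16 15 8
          by (simp flip: one_pCons)
        \<comment> \<open>The first divisor is monic, which starts the coprimality invariant of the
          Euclidean pair.\<close>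
        have "coeff ?F m = 1" using 16 15 8 N m by (simp add: coeff_lincomb_poly)
        moreover have "same_ideal N m a ?F ?G"
          unfolding same_ideal_def
        proof (intro allI impI)
          fix J assume J: "poly_ideal J" "[:N:] \<in> J"
          have "(P \<in> J) = (Q \<in> J)" if "P - Q \<in> J" for P Q
            using poly_ideal_add[OF J(1) that, of Q] poly_ideal_diff[OF J(1) _ that, of P] by auto
          moreover have "?F - (monom 1 1 ^ m - 1) \<in> J" "?G - ([:a, -1:] ^ m - 1) \<in> J"
            using F G J poly_ideal_zero[OF J(1)] by (auto simp: represents_def)
          ultimately show "?F \<in> J \<and> ?G \<in> J \<longleftrightarrow> monom 1 1 ^ m - 1 \<in> J \<and> [:a, -1:] ^ m - 1 \<in> J" by blast
        qed
        ultimately have "euclid_pair N m a m (int m) ?F ?G"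
          using F G by (simp add: euclid_pair_def represents_def)
        thus ?case using 16 15 8 by (auto simp: euclid_state_def)
      next
        case 15
        show ?case using lincomb_cost_ge by (simp add: algebra_simps)
      qed (use L N m valid_regs[OF v] in \<open>simp_all add: store_update_apply\<close>)
    qed (use L N m valid_regs[OF u] in \<open>simp_all add: store_update_apply algebra_simps\<close>)
  qed (use 1 in \<open>simp_all add: algebra_simps\<close>)
qed (simp add: algebra_simps)

lemma mult_reduce_step_correct:
  assumes s: "valid s" "s 0 9 = int d" "d \<le> m" and A: "A \<in> {2..8}"
    and ex: "bounded L ex s" "val ex s = x" "0 \<le> x" "x < N"
    and ey: "bounded L ey (store_update s 0 3 x)" "val ey (store_update s 0 3 x) = y" "0 \<le> y" "y < N"
    and nodes: "nodes ex + nodes ey \<le> 16"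
  shows "runs w L (mult_reduce_step A ex ey) s (2 * lincomb_cost)
    (\<lambda>t. valid t \<and> (\<forall>c. c \<notin> {3..8} \<longrightarrow> t 0 c = s 0 c) \<and>
      poly_of t A = mult_reduce N m (poly_of s 1) d x y (poly_of s A) \<and>
      (\<forall>b. b \<noteq> 0 \<longrightarrow> b \<noteq> A \<longrightarrow> poly_of t b = poly_of s b))"
  unfolding mult_reduce_step_def
proof (rule runs_Seq[OF lincomb_runs[OF s(1), where x = x and y = y and k = 1]], goal_cases)
  case (15 u)
  have u: "valid u" "u 0 9 = int d" using 15 s by auto
  have b: "\<bar>int d\<bar> < 2 ^ L" using s L by linarith
  have A': "A \<in> {1..8}" "A \<noteq> 0" "A \<noteq> 1" using A by auto
  have 1: "u 1 (int d) = coeff (poly_of u 1) d" "0 \<le> coeff (poly_of u 1) d" "coeff (poly_of u 1) d < N"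
    using valid_get(2,3)[OF u(1), of 1 "int d"] valid_get(4)[OF u(1), of 1 d] by auto
  have 2: "u A (int d) = coeff (poly_of u A) d" "0 \<le> coeff (poly_of u A) d" "coeff (poly_of u A) d < N"
    using valid_get(2,3)[OF u(1) A'(1), of "int d"] valid_get(4)[OF u(1) A'(1), of d] by auto
  show ?case
  proof (rule runs_mono[OF lincomb_runs[OF u(1), where x = "coeff (poly_of u 1) d" and y = "coeff (poly_of u A) d" and k = 0]], goal_cases)
    case (16 t)
    thus ?case using 15 A' by (simp add: mult_reduce_def Let_def)
  qed (use L N m u b 1 2 A' in \<open>simp_all add: store_update_apply\<close>)
qed (use A ex ey nodes m L in simp_all)

definition search_inv :: "nat \<Rightarrow> int poly \<Rightarrow> nat \<Rightarrow> store \<Rightarrow> bool"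
  where "search_inv d F j t \<longleftrightarrow> valid t \<and> t 0 9 = int d \<and> t 0 13 = int j \<and> j \<le> m \<and> poly_of t 1 = F \<and>
    (t 0 11 = 0 \<longrightarrow> euclid_pair N m a d (-1) F 0 \<and>
      represents N F d (coeff F d ^ (m - j)) ([:a, -1:] ^ (m - j)) (poly_of t 4) \<and>
      represents N F d (coeff F d ^ (m - j)) (monom 1 1 ^ (m - j)) (poly_of t 5) \<and>
      represents N F d (coeff F d ^ (m - j)) 1 (poly_of t 6) \<and>
      (\<forall>r. 1 \<le> r \<longrightarrow> r \<le> m - j \<longrightarrow> tested N F d a r))"

lemma search_step:
  assumes F: "euclid_pair N m a d (-1) F 0" and d: "d \<le> m"
    and Q: "represents N F d (coeff F d ^ r) ([:a, -1:] ^ r) Q"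
    and R: "represents N F d (coeff F d ^ r) (monom 1 1 ^ r) R"
    and S: "represents N F d (coeff F d ^ r) 1 S"
  defines "Q' \<equiv> mult_reduce N m F d a 1 Q" and "R' \<equiv> mult_reduce N m F d 0 (N - 1) R"
    and "S' \<equiv> lincomb_poly N m (coeff F d) 0 0 S S"
  shows "represents N F d (coeff F d ^ Suc r) ([:a, -1:] ^ Suc r) Q'"
    and "represents N F d (coeff F d ^ Suc r) (monom 1 1 ^ Suc r) R'"
    and "represents N F d (coeff F d ^ Suc r) 1 S'"
    and "represents N F d (coeff F d ^ Suc r) (power_sum_defect a (Suc r))
      (lincomb_poly N m 1 a 0 (lincomb_poly N m 1 (N - 1) 0 Q' R') S')"
proof -
  have Fd: "\<And>i. i > d \<Longrightarrow> coeff F i = 0" using F by (simp add: euclid_pair_def)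
  show Q': "represents N F d (coeff F d ^ Suc r) ([:a, -1:] ^ Suc r) Q'"
    using represents_mult_reduce[OF Q Fd d, of a 1 "[:a, -1:]"] by (simp add: Q'_def)
  have "[:N:] dvd [:0, - (N - 1):] - monom 1 1"
    by (rule dvdI[of _ _ "[:0, -1:]"]) (simp add: monom_altdef)
  from represents_mult_reduce[OF R Fd d this]
  show R': "represents N F d (coeff F d ^ Suc r) (monom 1 1 ^ Suc r) R'" by (simp add: R'_def)
  show S': "represents N F d (coeff F d ^ Suc r) 1 S'"
    using represents_lincomb_poly[OF S S, of m "coeff F d" 0] d by (simp add: S'_def)
  have "represents N F d (coeff F d ^ Suc r) ([:a, -1:] ^ Suc r - smult (N - 1) (monom 1 1 ^ Suc r)) (lincomb_poly N m 1 (N - 1) 0 Q' R')"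
    using represents_lincomb_poly[OF Q' R', of m 1 "N - 1"] d by simp
  moreover have "[:N:] dvd (e - smult (N - 1) f) - (e + f)" for e f :: "int poly"
    by (rule dvdI[of _ _ "- f"]) (simp add: smult_diff_left)
  ultimately have "represents N F d (coeff F d ^ Suc r) ([:a, -1:] ^ Suc r + monom 1 1 ^ Suc r) (lincomb_poly N m 1 (N - 1) 0 Q' R')"
    by (rule represents_cong)
  from represents_lincomb_poly[OF this S', of m 1 a] d
  show "represents N F d (coeff F d ^ Suc r) (power_sum_defect a (Suc r))
      (lincomb_poly N m 1 a 0 (lincomb_poly N m 1 (N - 1) 0 Q' R') S')"
    by (simp add: power_sum_defect_def add.commute)
qed

lemma search_body_correct:
  assumes t: "search_inv d F j t" and j: "0 < j" and d: "d \<le> m"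
  shows "runs w L search_body t (10 * lincomb_cost) (search_inv d F (j - 1))"
proof -
  have t': "valid t" "t 0 9 = int d" "t 0 13 = int j" "j \<le> m" "poly_of t 1 = F" using t by (auto simp: search_inv_def)
  have b: "\<bar>int d\<bar> < 2 ^ L" "\<bar>int j\<bar> < 2 ^ L" "\<bar>int j - 1\<bar> < 2 ^ L" using t' d L by linarith+
  note tr = valid_regs[OF t'(1)]
  show ?thesis
    unfolding search_body_def
  proof (rule runs_Seq[OF mult_reduce_step_correct[OF t'(1,2) d, where x = a and y = 1]], goal_cases)
    case (11 t1)
    hence t1: "valid t1" "t1 0 9 = int d" "t1 0 13 = int j" using t' by auto
    note h1 = 11 and t1r = valid_regs[OF t1(1)]
    show ?case
    proof (rule runs_Seq[OF mult_reduce_step_correct[OF t1(1,2) d, where x = 0 and y = "N - 1"]], goal_cases)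
      case (11 t2)
      hence t2: "valid t2" "t2 0 9 = int d" "t2 0 13 = int j" using t1 by auto
      note h2 = 11 and t2r = valid_regs[OF t2(1)]
      have t2p: "poly_of t2 1 = F" using h1 h2 t' by simp
      have lc: "t2 1 (int d) = coeff F d" "0 \<le> coeff F d" "coeff F d < N"
        using valid_get(2,3)[OF t2(1), of 1 "int d"] valid_get(4)[OF t2(1), of 1 d] t2p by auto
      show ?case
      proof (rule runs_Seq[OF lincomb_runs[OF t2(1), where x = "coeff F d" and y = 0 and k = 0]], goal_cases)
        case (15 t3)
        hence t3: "valid t3" "t3 0 9 = int d" "t3 0 13 = int j" using t2 by auto
        note h3 = 15
        show ?case
        proof (rule runs_Seq[OF copy_poly_correct[OF t3(1)]], goal_cases)
          case (3 t4)
          hence t4: "valid t4" "t4 0 9 = int d" "t4 0 13 = int j" using t3 by auto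
          note h4 = 3 and t4r = valid_regs[OF t4(1)]
          show ?case
          proof (rule runs_Seq[OF lincomb_runs[OF t4(1), where x = 1 and y = "N - 1" and k = 0]], goal_cases)
            case (15 t5)
            hence t5: "valid t5" "t5 0 9 = int d" "t5 0 13 = int j" using t4 by auto
            note h5 = 15 and t5r = valid_regs[OF t5(1)]
            show ?case
            proof (rule runs_Seq[OF lincomb_runs[OF t5(1), where x = 1 and y = a and k = 0]], goal_cases)
              case (15 t6)
              hence t6: "valid t6" "t6 0 9 = int d" "t6 0 13 = int j" using t5 by auto
              note h6 = 15
              show ?case
              proof (rule runs_Seq[OF test_coeffs_correct[OF t6(1)]], goal_cases)
                case (2 t7)
                note h7 = 2
                have t7: "valid t7" "t7 0 9 = int d" "t7 0 13 = int j" using h7 t6 by auto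
                have p7: "poly_of t7 b = poly_of t6 b" if "b \<noteq> 0" for b using h7 that by (intro poly_of_cong) simp
                let ?Q = "mult_reduce N m F d a 1 (poly_of t 4)" and ?R = "mult_reduce N m F d 0 (N - 1) (poly_of t 5)"
                let ?S = "lincomb_poly N m (coeff F d) 0 0 (poly_of t 6) (poly_of t 6)"
                have p6: "poly_of t6 1 = F" "poly_of t6 4 = ?Q" "poly_of t6 5 = ?R" "poly_of t6 6 = ?S"
                  "poly_of t6 7 = lincomb_poly N m 1 a 0 (lincomb_poly N m 1 (N - 1) 0 ?Q ?R) ?S"
                  using h1 h2 h3 h4 h5 h6 t' t2p by simp_all
                have "search_inv d F (j - 1) (store_update t7 0 13 (int j - 1))"
                proof -
                  \<comment> \<open>Cell 11 is never reset to 0: if it is 0 now, it was so at the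
                    start of the round, and the invariant for the polynomials applies.\<close>
                  have "t 0 11 = 0 \<and> (\<forall>i. coprime (coeff (poly_of t6 7) i) N \<or> N dvd coeff (poly_of t6 7) i)" if "t7 0 11 = 0"
                    using that h1 h2 h3 h4 h5 h6 h7 by simp
                  moreover have "euclid_pair N m a d (-1) F 0 \<and>
                      represents N F d (coeff F d ^ (m - (j - 1))) ([:a, -1:] ^ (m - (j - 1))) ?Q \<and>
                      represents N F d (coeff F d ^ (m - (j - 1))) (monom 1 1 ^ (m - (j - 1))) ?R \<and>
                      represents N F d (coeff F d ^ (m - (j - 1))) 1 ?S \<and>
                      (\<forall>r. 1 \<le> r \<longrightarrow> r \<le> m - (j - 1) \<longrightarrow> tested N F d a r)"
                    if z: "t 0 11 = 0" "\<forall>i. coprime (coeff (poly_of t6 7) i) N \<or> N dvd coeff (poly_of t6 7) i"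
                  proof -
                    have I: "euclid_pair N m a d (-1) F 0"
                      "represents N F d (coeff F d ^ (m - j)) ([:a, -1:] ^ (m - j)) (poly_of t 4)"
                      "represents N F d (coeff F d ^ (m - j)) (monom 1 1 ^ (m - j)) (poly_of t 5)"
                      "represents N F d (coeff F d ^ (m - j)) 1 (poly_of t 6)"
                      "\<And>r. 1 \<le> r \<Longrightarrow> r \<le> m - j \<Longrightarrow> tested N F d a r"
                      using t z by (auto simp: search_inv_def)
                    have mj: "m - (j - 1) = Suc (m - j)" using j t' by simp
                    note st = search_step[OF I(1) d I(2-4), folded mj]
                    have tt: "tested N F d a (m - (j - 1))"
                      unfolding tested_def using st(4) z p6 by auto
                    have "tested N F d a r" if "1 \<le> r" "r \<le> m - (j - 1)" for r
                    proof (cases "r = m - (j - 1)")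
                      case True
                      show ?thesis using tt unfolding True .
                    next
                      case False
                      hence "r \<le> m - j" using that(2) mj by linarith
                      thus ?thesis by (rule I(5)[OF that(1)])
                    qed
                    thus ?thesis using I st by blast
                  qed
                  ultimately show ?thesis
                    using t7 t' p7 p6 j
                    by (auto simp: search_inv_def store_update_apply poly_of_store_update_reg valid_store_update_reg of_nat_diff)
                qed
                thus ?case by (intro runs_Put) (use L t7 b lincomb_cost_ge in simp_all)
              qed (use lincomb_cost_ge in simp_all)
            qed (use L N m a t5r in \<open>simp_all add: store_update_apply\<close>)
          qed (use L N m a t4r in \<open>simp_all add: store_update_apply\<close>)
        qed simp_all
      qed (use L N m t2 b lc in \<open>simp_all add: store_update_apply\<close>)
    qed (use L N m a t1r in \<open>simp_all add: store_update_apply\<close>)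
  qed (use L N m a tr in \<open>simp_all add: store_update_apply\<close>)
qed


text \<open>If cell 11 were still 0 after \<open>m\<close> rounds, the remainders for all exponents
  from 1 to \<open>m\<close> would have passed the test, contrary to the separating coefficient of
  one of them. A nonzero cell 11 holds a proper divisor by \<open>valid\<close>.\<close>

lemma search_correct:
  assumes nat: "natural_property N0 m a0" and N0: "N = int N0" and a0: "[a0 = a] (mod N)"
    and s: "euclid_state d (-1) s"
  shows "runs w L (Seq (set_reg 13 (reg 1)) (Seq (Loop (reg 13) search_body) (set_reg 0 (reg 11)))) s
    ((m + 4) * (10 * lincomb_cost + 2)) (\<lambda>t. 1 < result t \<and> result t < N \<and> result t dvd N)"
proof -
  define F where "F = poly_of s 1"
  have s': "valid s" "d \<le> m" using s by (auto simp: euclid_state_def)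
  have pair: "euclid_pair N m a d (-1) F 0" if "s 0 11 = 0"
  proof -
    have e: "euclid_pair N m a d (-1) F (poly_of s 2)" using s that by (simp add: euclid_state_def F_def)
    hence "poly_of s 2 = 0" by (simp add: euclid_pair_def poly_eq_iff)
    thus ?thesis using e by simp
  qed
  have a0': "[a0 = a] (mod int N0)" using a0 N0 by simp
  have d_pos: "0 < d" if "euclid_pair N m a d (-1) F 0"
    using that N0 by (intro same_ideal_degree_pos[OF nat a0', of d F]) (auto simp: euclid_pair_def)
  show ?thesis
  proof (rule runs_Put_Seq, goal_cases)
    case 4
    let ?u = "store_update s 0 (val (Lit 13) s) (val (reg 1) s)"
    have loop: "runs w L (Loop (reg 13) search_body) ?u (m * (2 + 10 * lincomb_cost) + 2) (search_inv d F 0)"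
    proof (rule runs_Loop[where I = "search_inv d F" and n = m and k = "10 * lincomb_cost"], goal_cases)
      case 1
      \<comment> \<open>Here positivity of \<open>d\<close> enters: the constant 1 has degree below
        \<open>d\<close>.\<close>
      have "represents N F d 1 1 1" if "0 < d" using that by (auto simp: represents_def poly_ideal_zero simp flip: one_pCons)
      thus ?case
        using s s' pair d_pos valid_regs[OF s'(1)]
        by (auto simp: search_inv_def F_def euclid_state_def store_update_apply poly_of_store_update_reg valid_store_update_reg)
    next
      case (2 j t)
      hence "t 0 13 = int j" "j \<le> m" by (simp_all add: search_inv_def)
      moreover from this have "\<bar>int j\<bar> < 2 ^ L" by (intro int_le_m_bounded) simp_all
      ultimately show ?case using L by simp
    next
      case (3 j t)
      hence "0 < j" by (simp add: search_inv_def)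
      thus ?case using search_body_correct[OF 3(1) _ s'(2)] by blast
    next
      case (4 j t)
      moreover from this have "j = 0" by (simp add: search_inv_def)
      ultimately show ?case by simp
    next
      case 5
      show ?case by simp
    qed
    show ?case
    proof (rule runs_Seq[OF loop], goal_cases)
      case (1 t)
      note 6 = 1
      have "t 0 11 \<noteq> 0"
      proof
        assume z: "t 0 11 = 0"
        have F: "euclid_pair N m a d (-1) F 0" and tested: "\<And>r. 1 \<le> r \<Longrightarrow> r \<le> m \<Longrightarrow> tested N F d a r"
          using 6 z by (auto simp: search_inv_def)
        have lc: "coprime (coeff F d) N" using F by (simp add: euclid_pair_def)
        obtain r where r: "1 \<le> r" "r \<le> m"
          "\<And>H c. coprime c (int N0) \<Longrightarrow> (\<And>i. i \<ge> d \<Longrightarrow> coeff H i = 0) \<Longrightarrow>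
            (\<And>J. poly_ideal J \<Longrightarrow> [:int N0:] \<in> J \<Longrightarrow> F \<in> J \<Longrightarrow> H - smult c (power_sum_defect a r) \<in> J) \<Longrightarrow>
            \<exists>i. gcd (coeff H i) (int N0) \<noteq> 1 \<and> \<not> int N0 dvd coeff H i"
          using F N0 by (rule_tac exists_separating_coeff[OF nat a0', of d F]) (auto simp: euclid_pair_def)
        obtain H where H: "represents N F d (coeff F d ^ r) (power_sum_defect a r) H"
          "\<And>i. coprime (coeff H i) N \<or> N dvd coeff H i"
          using tested[OF r(1,2)] by (auto simp: tested_def)
        have "\<exists>i. gcd (coeff H i) (int N0) \<noteq> 1 \<and> \<not> int N0 dvd coeff H i"
          using H(1) lc N0 by (intro r(3)[of "coeff F d ^ r"]) (auto simp: represents_def)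
        thus False using H(2) N0 by (metis coprime_iff_gcd_eq_1)
      qed
      hence D: "1 < t 0 11" "t 0 11 < N" "t 0 11 dvd N" using 6 by (auto simp: search_inv_def valid_def)
      show ?case
        by (rule runs_Put) (use L D lincomb_cost_ge in \<open>simp_all add: result_def store_update_apply algebra_simps\<close>)
    next
      case 2
      show ?case using m by (simp add: algebra_simps)
    qed
  qed (use L nat_less_power[OF L(3)] valid_regs[OF s'(1)] in simp_all)
qed

lemma factor_odd_correct:
  assumes nat: "natural_property N0 m a0" and N0: "N = int N0" and a0: "[a0 = a] (mod N)"
  shows "runs w L factor_odd (init_store [N, int m, a]) ((m + 4) * (21 * lincomb_cost + 240))
    (\<lambda>t. 1 < result t \<and> result t < N \<and> result t dvd N)"
  unfolding factor_odd_def
proof (rule runs_Seq[OF setup_polys_correct], goal_cases)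
  case (1 t)
  show ?case
  proof (rule runs_Seq[OF euclid_correct[OF 1]], goal_cases)
    case (1 u)
    then obtain d where "euclid_state d (-1) u" by blast
    from search_correct[OF assms this] show ?case
      by (rule runs_mono) (simp_all add: algebra_simps)
  qed (simp add: algebra_simps)
qed (simp add: algebra_simps)

lemma factor_program_correct:
  assumes nat: "natural_property N0 m a0" and N0: "N = int N0" and a0: "[a0 = a] (mod N)"
  shows "runs w L factor_program (init_store [N, int m, a]) ((m + 4) * (21 * lincomb_cost + 250))
    (\<lambda>t. 1 < result t \<and> result t < N \<and> result t dvd N)"
  unfolding factor_program_def
proof (rule runs_Cond, goal_cases)
  case 3
  show ?case by (rule runs_mono[OF factor_odd_correct[OF assms]]) (simp_all add: algebra_simps)
next
  case 4
  have "0 < val (parity (reg 0)) (init_store [N, int m, a])"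
    using N by (simp add: init_store_apply) presburger
  thus ?case using 4 by simp
next
  case 1
  have "N = 2 * (N div 2) + 1" using N(3) by simp
  hence "N div 2 < 2 ^ L" "2 * (N div 2) < 2 ^ L" "0 \<le> N div 2" "N - 2 * (N div 2) = 1" using L N by linarith+
  thus ?case using L N by (simp add: init_store_apply)
next
  case 2
  have "1 * 250 \<le> (m + 4) * (21 * lincomb_cost + 250)" by (intro mult_le_mono) simp_all
  thus ?case by simp
qed

end

section \<open>Even numbers and the numerical bound\<close>

lemma factor_program_even:
  assumes L: "16 * N < 2 ^ L" "64 \<le> (2::int) ^ L" and N: "2 < N" "even N"
  shows "runs w L factor_program (init_store (N # xs)) 20 (\<lambda>t. 1 < result t \<and> result t < N \<and> result t dvd N)"
  unfolding factor_program_def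
proof (rule runs_Cond, goal_cases)
  case 3
  thus ?case using N(2) by (auto simp: init_store_apply elim!: evenE)
next
  case 4
  show ?case by (rule runs_Put) (use L N in \<open>simp_all add: result_def store_update_apply\<close>)
qed (use L N in \<open>simp_all add: init_store_apply\<close>)

lemma expr_cost_pos: "0 < expr_cost w e s"
  by (cases e) (simp_all add: num_words_def)

lemma exec_cost_pos: "exec w c s k t \<Longrightarrow> 0 < k"
  by (induction rule: exec.induct) (simp_all add: expr_cost_pos)

text \<open>Every run costs at least one word operation, in particular the multiplication of 0 by 0,
  and costs are integers.\<close>

lemma multiplication_time_ge_1:
  assumes "multiplication_time w M" "1 \<le> n"
  shows "1 \<le> M n"
proof -
  obtain P where "\<exists>k. computes w P [0, 0] (0 * 0) k \<and> real k \<le> M n"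
    using assms unfolding multiplication_time_def by (metis bit_length_def abs_zero floorlog_eq_zero_iff nat_zero_as_int of_nat_0 zero_le nat_0)
  then obtain k where "computes w P [0, 0] (0 * 0) k" "real k \<le> M n" by blast
  moreover from this have "0 < k" using exec_cost_pos by (auto simp: computes_def)
  ultimately show ?thesis by linarith
qed

text \<open>Applied to the bit length of \<open>m\<close>, whose square is thus O(m).\<close>

lemma square_le_power: "l ^ 2 \<le> 4 * (2::nat) ^ l"
proof (induction l)
  case (Suc l)
  have "2 * l + 1 \<le> 4 * (2::nat) ^ l"
  proof (induction l)
    case (Suc l)
    moreover have "2 * Suc l + 1 \<le> 8 * x" if "2 * l + 1 \<le> 4 * x" "1 \<le> x" for x :: nat using that by presburger
    ultimately show ?case by simp
  qed simp
  thus ?case using Suc by (simp add: power2_eq_square)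
qed simp

text \<open>There are O(m^2 n) nodes at price \<open>L + 1\<close>, which is
  \<open>n + l + 7\<close> for the bit length \<open>l\<close> of \<open>m\<close>. The mixed term
  \<open>n * l\<close> is at most \<open>n ^ 2 + l ^ 2\<close>, and the square of \<open>l\<close>
  is O(m); this produces the summand m^3.\<close>

lemma cost_bound:
  assumes m: "3 \<le> m" and N: "3 \<le> N"
    and n_def: "n = floorlog 2 N" and L_def: "L = n + floorlog 2 m + 6"
    and k: "k \<le> (m + 4) * (21 * ((m + 2) * (220 * n + 130)) + 250) * (L + 1)"
  shows "real k \<le> 4000000 * (real m ^ 3 + (real m)\<^sup>2 * (ln (real N))\<^sup>2)"
proof -
  define l where "l = floorlog 2 m"
  have n1: "1 \<le> n" using N by (simp add: n_def floorlog_def)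
  have "2 ^ (l - 1) \<le> m" using floorlog_bounds[of m 2] m by (simp add: l_def)
  moreover have "l \<noteq> 0" using m by (simp add: l_def floorlog_eq_zero_iff)
  ultimately have "(2::nat) ^ l \<le> 2 * m" by (cases l) simp_all
  hence l2: "l ^ 2 \<le> 8 * m" using square_le_power[of l] by linarith
  have "n * l \<le> n ^ 2 + l ^ 2"
    by (metis (no_types, lifting) le_add1 le_add2 le_trans mult_le_mono nle_le power2_eq_square)
  hence nl: "n * (L + 1) \<le> 9 * n ^ 2 + 8 * m"
  proof -
    have "n \<le> n * n" by simp
    moreover have "n * (L + 1) = n * n + n * l + 7 * n" by (simp add: L_def l_def[symmetric] algebra_simps)
    ultimately show ?thesis using l2 \<open>n * l \<le> n\<^sup>2 + l\<^sup>2\<close> unfolding power2_eq_square by linarith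
  qed
  have "k \<le> (m + 4) * (21 * ((m + 2) * (220 * n + 130)) + 250) * (L + 1)" by (rule k)
  \<comment> \<open>Here \<open>m + 4 \<le> 3 * m\<close> and \<open>m + 2 \<le> 2 * m\<close> use
    \<open>m \<ge> 3\<close>, the rest uses \<open>n \<ge> 1\<close>; 44850 is 3 (21 * 2 * 350 +
    250).\<close>
  also have "\<dots> \<le> (3 * m) * (21 * ((2 * m) * (350 * n)) + 250 * (m * n)) * (L + 1)"
    using m n1 by (intro mult_le_mono add_mono) auto
  also have "\<dots> = 44850 * (m ^ 2 * (n * (L + 1)))" by (simp add: algebra_simps power2_eq_square)
  also have "\<dots> \<le> 44850 * (m ^ 2 * (9 * n ^ 2 + 8 * m))" by (intro mult_le_mono le_refl nl)
  also have "\<dots> \<le> 44850 * (9 * (m ^ 3 + m ^ 2 * n ^ 2))" by (simp add: algebra_simps power2_eq_square power3_eq_cube)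
  finally have "real k \<le> real (44850 * (9 * (m ^ 3 + m ^ 2 * n ^ 2)))" by (rule of_nat_mono)
  also have "\<dots> = 403650 * (real m ^ 3 + (real m)\<^sup>2 * (real n)\<^sup>2)" by simp
  \<comment> \<open>\<open>N \<ge> 3\<close> exceeds e, so its logarithm is at least 1 and absorbs
    the rounding of the bit length. The square of 3 turns 403650 into 3632850, below the final
    constant.\<close>
  also have "\<dots> \<le> 403650 * (real m ^ 3 + (real m)\<^sup>2 * (3 * ln (real N))\<^sup>2)"
  proof -
    have "exp 1 \<le> real N" using exp_le N by linarith
    hence lnN: "1 \<le> ln (real N)" using N by (subst ln_ge_iff) auto
    have "real n \<le> log 2 (real N) + 1" using N by (simp add: n_def floorlog_def)
    also have "log 2 (real N) \<le> 2 * ln (real N)"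
    proof -
      have "(exp (1 / 2 :: real))\<^sup>2 \<le> 2\<^sup>2" using exp_le by (simp add: power2_eq_square flip: exp_add)
      hence "exp (1 / 2 :: real) \<le> 2" by (rule power2_le_imp_le) simp
      hence "1 / 2 \<le> ln (2 :: real)" by (subst ln_ge_iff) simp_all
      hence "ln (real N) * (1 / 2) \<le> ln (real N) * ln 2" using lnN by (intro mult_left_mono) simp_all
      thus ?thesis by (simp add: log_def field_simps)
    qed
    finally have "real n \<le> 3 * ln (real N)" using lnN by linarith
    thus ?thesis by (intro mult_left_mono add_mono power_mono) auto
  qed
  also have "\<dots> \<le> 4000000 * (real m ^ 3 + (real m)\<^sup>2 * (ln (real N))\<^sup>2)"
    by (simp add: power_mult_distrib)
  finally show ?thesis .
qed

theorem theorem6p11: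
  fixes w :: nat and M :: "nat \<Rightarrow> real"
  assumes "w > 0" and "multiplication_time w M"
  shows "\<exists>(P :: program) (C :: real). \<forall>(N :: nat) (m :: nat) (a :: int).
    N \<in> \<T> \<longrightarrow> m \<ge> 1 \<longrightarrow> natural_property N m a \<longrightarrow>
      (\<exists>(d :: nat) (k :: nat).
        computes w P [int N, int m, a mod int N] (int d) k \<and>
        proper_divisor d N \<and>
        real k \<le> C * (real (totient m)
                        * (real m ^ 3 + (real m)\<^sup>2 * (ln (real N))\<^sup>2)
                        * M (nat \<lfloor>log 2 (real N)\<rfloor> + 1)))"
proof (intro exI[of _ factor_program] exI[of _ "4000000 :: real"] allI impI)
  fix N m :: nat and a :: int
  assume T: "N \<in> \<T>" and nat: "natural_property N m a"
  have m: "3 \<le> m" using nat by (simp add: natural_property_def)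
  have N: "3 \<le> N"
  proof (rule ccontr)
    assume "\<not> 3 \<le> N"
    have "prime_factors N \<subseteq> {2}"
    proof
      fix p assume "p \<in> prime_factors N"
      hence "Factorial_Ring.prime p" "p dvd N" by auto
      moreover have "0 < N" using T by (simp add: two_prime_numbers_def)
      ultimately have "2 \<le> p" "p \<le> N" by (auto intro: prime_ge_2_nat dvd_imp_le)
      thus "p \<in> {2}" using \<open>\<not> 3 \<le> N\<close> by simp
    qed
    from card_mono[OF _ this] show False using T by (simp add: two_prime_numbers_def)
  qed
  define n where "n = floorlog 2 N"
  \<comment> \<open>Six extra bits give the factor 16 over both \<open>N\<close> and
    \<open>m\<close>, and the lower bound 64.\<close>
  define L where "L = n + floorlog 2 m + 6"
  define K where "K = (m + 4) * (21 * ((m + 2) * (220 * n + 130)) + 250)"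
  have Nn: "N < 2 ^ n" and ml: "m < 2 ^ floorlog 2 m" using floorlog_bounds[of N 2] floorlog_bounds[of m 2] N m by (auto simp: n_def)
  have "2 ^ L = 64 * 2 ^ n * (2::nat) ^ floorlog 2 m" by (simp add: L_def power_add)
  moreover have "2 ^ n * 1 \<le> 2 ^ n * (2::nat) ^ floorlog 2 m" "1 * 2 ^ floorlog 2 m \<le> 2 ^ n * (2::nat) ^ floorlog 2 m"
    by (intro mult_le_mono; simp)+
  ultimately have "16 * N < 2 ^ L" "64 \<le> (2::nat) ^ L" "16 * m < 2 ^ L"
    using Nn ml N by linarith+
  hence L: "16 * int N < 2 ^ L" "64 \<le> (2::int) ^ L" "16 * int m < 2 ^ L"
    by (metis of_nat_less_iff of_nat_mult of_nat_numeral of_nat_power of_nat_le_iff)+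
  have "runs w L factor_program (init_store [int N, int m, a mod int N]) K
    (\<lambda>t. 1 < result t \<and> result t < int N \<and> result t dvd int N)"
  proof (cases "even N")
    case True
    show ?thesis
    proof (rule runs_mono[OF factor_program_even[OF L(1,2)]])
      have "1 * 250 \<le> K" unfolding K_def by (intro mult_le_mono) simp_all
      thus "20 \<le> K" by simp
    qed (use N True in auto)
  next
    case False
    interpret factoring_setup w L n m "int N" "a mod int N"
      using L N m False Nn by unfold_locales (auto simp flip: of_nat_less_iff)
    show ?thesis
      using factor_program_correct[OF nat refl] by (simp add: K_def lincomb_cost_def cong_def)
  qed
  then obtain k t where t: "exec w factor_program (init_store [int N, int m, a mod int N]) k t"
    "k \<le> K * (L + 1)" "1 < result t" "result t < int N" "result t dvd int N" by (auto simp: runs_def)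
  define d where "d = nat (result t)"
  have d: "int d = result t" using t by (simp add: d_def)
  have "proper_divisor d N" using t d by (metis nat_int_comparison(1) less_irrefl of_nat_1 of_nat_dvd_iff proper_divisor_def)
  moreover have "computes w factor_program [int N, int m, a mod int N] (int d) k"
    using t d by (auto simp: computes_def)
  moreover have "real k \<le> 4000000 * (real (totient m) * (real m ^ 3 + (real m)\<^sup>2 * (ln (real N))\<^sup>2)
                        * M (nat \<lfloor>log 2 (real N)\<rfloor> + 1))"
  proof -
    let ?B = "real m ^ 3 + (real m)\<^sup>2 * (ln (real N))\<^sup>2"
    \<comment> \<open>The totient and \<open>M\<close> are at least 1 here, so multiplying by them
      preserves the bound.\<close>
    have "0 \<le> ?B" by simp
    moreover have "1 \<le> real (totient m)" using m by (simp add: Suc_leI)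
    moreover have "1 \<le> M (nat \<lfloor>log 2 (real N)\<rfloor> + 1)" by (rule multiplication_time_ge_1[OF assms(2)]) simp
    ultimately have "1 * ?B * 1 \<le> real (totient m) * ?B * M (nat \<lfloor>log 2 (real N)\<rfloor> + 1)"
      by (intro mult_mono) auto
    moreover have "real k \<le> 4000000 * ?B"
      using cost_bound[OF m N n_def L_def] t(2) by (simp add: K_def)
    ultimately show ?thesis by linarith
  qed
  ultimately show "\<exists>(d :: nat) (k :: nat).
        computes w factor_program [int N, int m, a mod int N] (int d) k \<and>
        proper_divisor d N \<and>
        real k \<le> 4000000 * (real (totient m)
                        * (real m ^ 3 + (real m)\<^sup>2 * (ln (real N))\<^sup>2)
                        * M (nat \<lfloor>log 2 (real N)\<rfloor> + 1))" by blast
qed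

end
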